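(* Consider the problem of minimizing $F=f+\psi$ and the inexact variable-metric block-coordinate descent algorithm (Algorithm A) described in the context, with parameters $\beta,\gamma\in(0,1)$, started at $x^0$ with $F(x^0)<\infty$. Assume that $f$ and $\psi$ are convex, that $f$ satisfies the blockwise Lipschitz condition with constants $L_1,\dots,L_N>0$, and that $R_0:=\sup_{x:\,F(x)\le F(x^0)}\|x-P_\Omega(x)\|$ is finite. Suppose that at all iterations $k$, and for any choice $i=i_k$ of the update block at iteration $k$, the $\eta$-approximate solution condition $\eta(Q^k_i(0)-Q^{k*}_i)\ge Q^k_i(d^k_i)-Q^{k*}_i$ holds with a fixed $\eta\in[0,1)$, and that $H^k_i\succeq m_iI$ for all $k=0,1,\dots$ and all $i$, for some $m_i>0$. Then the following are true. 1. At iteration $k$, given any probability distribution $\{p^k_i\}_{i=1}^N>0$ for choosing the update block $i_k$, let $\{\alpha^k_i\}_{i=1}^N>0$ be the step sizes generated by the backtracking line search for each possible choice $i=1,\dots,N$, and let $$\pi^k:=\min_{1\le i\le N}\alpha^k_ip^k_i,\quad \mathcal P_k:=\mathrm{diag}(p^k_1I_{n_1},\dots,p^k_NI_{n_N}),\quad \mathcal A_k:=\mathrm{diag}(\alpha^k_1I_{n_1},\dots,\alpha^k_NI_{n_N}),\quad \mathcal H_k:=\mathrm{diag}(H^k_1,\dots,H^k_N).$$ If $F(x^k)>F^*$ and $$F(x^k)-F^*\ge (x^k-P_\Omega(x^k))^\top\mathcal P_k^{-1}\mathcal A_k^{-1}\mathcal H_k\,(x^k-P_\Omega(x^k))\,\pi^k,$$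 then $$\frac{\mathbb E_{i_k}[F(x^{k+1})-F^*\mid x^k]}{F(x^k)-F^*}\le 1-\frac{(1-\eta)\gamma\pi^k}{2}.$$ 2. Let $M_i\ge m_i$, $i=1,\dots,N$, be given, and let $$\mathcal M:=\mathrm{diag}(M_1I_{n_1},\dots,M_NI_{n_N}),\qquad \bar{\mathcal A}:=\mathrm{diag}(\bar\alpha_1I_{n_1},\dots,\bar\alpha_NI_{n_N}),\qquad \bar\alpha_i:=\min\Big\{1,\frac{2\beta(1-\gamma)m_i}{L_i(1+\sqrt\eta)}\Big\}.$$ Given a probability distribution $\{p_i\}_{i=1}^N>0$, let $\mathcal P:=\mathrm{diag}(p_1I_{n_1},\dots,p_NI_{n_N})$, $\bar\pi:=\min_{1\le i\le N}\bar\alpha_ip_i$, and let $k_0$ be the smallest $k$ such that $F(x^k)-F^*<\|\mathcal P^{-1}\bar{\mathcal A}^{-1}\mathcal M\|\,\bar\pi R_0^2$. Suppose that for all $k\ge k_0$ the sampling of $i_k$ follows the distribution $\{p_i\}$, which does not depend on $k$, and that $M_iI\succeq H^k_i\succeq m_iI$ for $i=1,\dots,N$. Then for $k\ge k_0$, $$\mathbb E_{i_{k_0},i_{k_0+1},\dots,i_{k-1}}[F(x^k)\mid x^{k_0}]-F^*\le\frac{2\|\mathcal P^{-1}\bar{\mathcal A}^{-1}\mathcal M\|R_0^2}{2N+(1-\eta)\gamma(k-k_0)}.$$ 3. Let $M_i$, $\mathcal M$, $\bar{\mathcal A}$, $\{p_i\}$, $\mathcal P$, $\bar\pi$ be as in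 part 2. Suppose that the fixed probability distribution $\{p_i\}_{i=1}^N>0$ is used throughout to sample the blocks, and that $M_iI\succeq H^k_i\succeq m_iI$ for $i=1,\dots,N$ and all $k\ge0$. Define $$\bar k_0:=\left\lceil\max\left\{0,\ \frac{\log\frac{F(x^0)-F^*}{\|\mathcal P^{-1}\bar{\mathcal A}^{-1}\mathcal M\|\bar\pi R_0^2}}{\log\left(\frac{2}{2-(1-\eta)\gamma\bar\pi}\right)}\right\}\right\rceil$$ (with $\bar k_0:=0$ if $F(x^0)=F^*$). Then for all $k<\bar k_0$, $$\mathbb E_{i_0,\dots,i_{k-1}}[F(x^k)-F^*]\le\Big(1-\frac{(1-\eta)\gamma\bar\pi}{2}\Big)^k(F(x^0)-F^* ),$$ while for all $k\ge\bar k_0$, $$\mathbb E_{i_0,\dots,i_{k-1}}[F(x^k)-F^*]\le\frac{2\|\mathcal P^{-1}\bar{\mathcal A}^{-1}\mathcal M\|R_0^2}{2N+(1-\eta)\gamma(k-\bar k_0)}.$$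
   Context: Problem. Minimize $F(x)=f(x)+\psi(x)$ over $x\in\mathbb R^n$, where $x=(x_1,\dots,x_N)$ is split into $N$ blocks $x_i\in\mathbb R^{n_i}$, $\sum_i n_i=n$. $U_i\in\mathbb R^{n\times n_i}$ is the column submatrix of the identity with $x_i=U_i^\top x$; $\nabla_if:=U_i^\top\nabla f$. $f:\mathbb R^n\to\mathbb R$ is continuously differentiable and blockwise Lipschitz: $\|\nabla_if(x+U_ih)-\nabla_if(x)\|\le L_i\|h\|$ for all $x\in\mathbb R^n$, $h\in\mathbb R^{n_i}$, with $L_i>0$. $\psi(x)=\sum_i\psi_i(x_i)$ with each $\psi_i$ convex, extended-valued, proper and closed. $F$ is bounded below and its set of minimizers $\Omega$ is nonempty; $F^*$ is the minimum value; $P_\Omega$ is the Euclidean projection onto $\Omega$. $\|\cdot\|$ is the Euclidean norm for vectors and the spectral norm for matrices; $\log$ is the natural logarithm. Algorithm A. Given $\beta,\gamma\in(0,1)$, $\eta\in[0,1)$, $x^0$. At iteration $k=0,1,2,\dots$: pick a probability distribution $p^k_1,\dots,p^k_N>0$, $\sum_ip^k_i=1$, and sample $i_k$ from it. For a block $i$, with a symmetric positive-definite matrix $H^k_i\in\mathbb R^{n_i\times n_i}$, let $$Q^k_i(d_i):=\nabla_if(x^k)^\top d_i+\tfrac12d_i^\top H^k_id_i+\psi_i(x^k_i+d_i)-\psi_i(x^k_i),\qquad Q^{k*}_i:=\inf_{d_i}Q^k_i(d_i).$$ For $i=i_k$, compute an $\eta$-approximate minimizer $d^k_i$ of $Q^k_i$,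 i.e. $\eta(Q^k_i(0)-Q^{k*}_i)\ge Q^k_i(d^k_i)-Q^{k*}_i$. With $\Delta^k_i:=\nabla_if(x^k)^\top d^k_i+\psi_i(x^k_i+d^k_i)-\psi_i(x^k_i)$, let $\alpha^k_i$ be the largest value in $\{1,\beta,\beta^2,\dots\}$ with $F(x^k+\alpha^k_iU_id^k_i)\le F(x^k)+\alpha^k_i\gamma\Delta^k_i$. Set $x^{k+1}=x^k+\alpha^k_{i_k}U_{i_k}d^k_{i_k}$. Conventions. At each iteration, $H^k_i,d^k_i,\alpha^k_i$ are considered for every $i=1,\dots,N$ as the quantities that would result if $i$ were chosen as $i_k$. $\mathbb E_{i_k}[\cdot\mid x^k]$ is the expectation over $i_k$ (distributed according to $\{p^k_i\}$) with everything up to iteration $k$ fixed; $\mathbb E_{i_a,\dots,i_b}$ is the expectation over the indicated block choices. *)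

theory Defs
  imports "HOL-Probability.Probability" "HOL-Library.Sublist"
begin

text \<open>
  A coordinate \<open>j :: 'n\<close> belongs to the block \<open>blk j :: 'b\<close>, so that \<open>N = CARD('b)\<close> and \<open>n_i\<close> is the
  number of coordinates \<open>j\<close> with \<open>blk j = i\<close>.  Since \<open>n_i\<close> depends on \<open>i\<close>, the space of \<open>i\<close>-th
  blocks is represented by its isometric image under \<open>U_i\<close>, the coordinate subspace
  \<open>block_space blk i\<close> of the full space: a block vector \<open>d_i\<close> is identified with \<open>U_i d_i\<close>,
  the block \<open>x_i\<close> of \<open>x\<close> with \<open>U_i U_i^T x\<close>, and an \<open>n_i\<close> by \<open>n_i\<close> matrix \<open>A\<close> with \<open>U_i A U_i^T\<close>.
\<close>

definition block_space :: "('n::finite \<Rightarrow> 'b) \<Rightarrow> 'b \<Rightarrow> (real^'n) set" where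
  "block_space blk i = {v. \<forall>j. blk j \<noteq> i \<longrightarrow> v $ j = 0}"

definition block_part :: "('n::finite \<Rightarrow> 'b) \<Rightarrow> 'b \<Rightarrow> real^'n \<Rightarrow> real^'n" where
  "block_part blk i x = (\<chi> j. if blk j = i then x $ j else 0)"

definition block_matrix :: "('n::finite \<Rightarrow> 'b) \<Rightarrow> 'b \<Rightarrow> real^'n^'n \<Rightarrow> bool" where
  "block_matrix blk i A \<longleftrightarrow> (\<forall>j k. \<not> (blk j = i \<and> blk k = i) \<longrightarrow> A $ j $ k = 0)"

definition block_id :: "('n::finite \<Rightarrow> 'b) \<Rightarrow> 'b \<Rightarrow> real^'n^'n" where
  "block_id blk i = (\<chi> j k. if j = k \<and> blk j = i then 1 else 0)"

definition block_diag :: "('n::finite \<Rightarrow> 'b) \<Rightarrow> ('b \<Rightarrow> real^'n^'n) \<Rightarrow> real^'n^'n" where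
  "block_diag blk A = (\<chi> j k. if blk j = blk k then A (blk j) $ j $ k else 0)"

definition block_spd :: "('n::finite \<Rightarrow> 'b) \<Rightarrow> 'b \<Rightarrow> real^'n^'n \<Rightarrow> bool" where
  "block_spd blk i A \<longleftrightarrow> block_matrix blk i A \<and> transpose A = A \<and>
     (\<forall>v\<in>block_space blk i. v \<noteq> 0 \<longrightarrow> v \<bullet> (A *v v) > 0)"

definition psd :: "real^'n^'n \<Rightarrow> bool" where
  "psd A \<longleftrightarrow> transpose A = A \<and> (\<forall>v. v \<bullet> (A *v v) \<ge> 0)"

definition loewner_ge :: "real^'n^'n \<Rightarrow> real^'n^'n \<Rightarrow> bool" (infix "\<succeq>" 50) where
  "A \<succeq> B \<longleftrightarrow> psd (A - B)"

abbreviation spectral_norm :: "real^'n^'n \<Rightarrow> real" where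
  "spectral_norm A \<equiv> onorm ((*v) A)"

definition ereal_epigraph :: "'a set \<Rightarrow> ('a \<Rightarrow> ereal) \<Rightarrow> ('a \<times> real) set" where
  "ereal_epigraph S g = {(v, t). v \<in> S \<and> g v \<le> ereal t}"

definition proper_closed_convex :: "'a::real_normed_vector set \<Rightarrow> ('a \<Rightarrow> ereal) \<Rightarrow> bool" where
  "proper_closed_convex S g \<longleftrightarrow>
     (\<forall>v\<in>S. g v \<noteq> -\<infinity>) \<and> (\<exists>v\<in>S. g v \<noteq> \<infinity>) \<and>
     closed (ereal_epigraph S g) \<and> convex (ereal_epigraph S g)"

text \<open>Each \<open>\<psi> i\<close> is only ever evaluated on \<open>block_space blk i\<close>.\<close>

definition objective ::
  "('n::finite \<Rightarrow> 'b::finite) \<Rightarrow> (real^'n \<Rightarrow> real) \<Rightarrow> ('b \<Rightarrow> real^'n \<Rightarrow> ereal) \<Rightarrow> real^'n \<Rightarrow> ereal" where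
  "objective blk f \<psi> x = ereal (f x) + (\<Sum>i\<in>UNIV. \<psi> i (block_part blk i x))"

definition minimizers :: "('a \<Rightarrow> ereal) \<Rightarrow> 'a set" where
  "minimizers F = {x. \<forall>y. F x \<le> F y}"

definition model ::
  "('n::finite \<Rightarrow> 'b) \<Rightarrow> (real^'n \<Rightarrow> real^'n) \<Rightarrow> ('b \<Rightarrow> real^'n \<Rightarrow> ereal) \<Rightarrow>
   real^'n^'n \<Rightarrow> real^'n \<Rightarrow> 'b \<Rightarrow> real^'n \<Rightarrow> ereal" where
  "model blk gradf \<psi> A x i d =
     ereal (block_part blk i (gradf x) \<bullet> d + (d \<bullet> (A *v d)) / 2)
     + \<psi> i (block_part blk i x + d) - \<psi> i (block_part blk i x)"

definition approx_minimizer :: "real \<Rightarrow> 'a::zero set \<Rightarrow> ('a \<Rightarrow> ereal) \<Rightarrow> 'a \<Rightarrow> bool" where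
  "approx_minimizer \<eta> S Q d \<longleftrightarrow>
     d \<in> S \<and> ereal \<eta> * (Q 0 - (INF v\<in>S. Q v)) \<ge> Q d - (INF v\<in>S. Q v)"

definition Delta ::
  "('n::finite \<Rightarrow> 'b) \<Rightarrow> (real^'n \<Rightarrow> real^'n) \<Rightarrow> ('b \<Rightarrow> real^'n \<Rightarrow> ereal) \<Rightarrow>
   real^'n \<Rightarrow> 'b \<Rightarrow> real^'n \<Rightarrow> ereal" where
  "Delta blk gradf \<psi> x i d =
     ereal (block_part blk i (gradf x) \<bullet> d)
     + \<psi> i (block_part blk i x + d) - \<psi> i (block_part blk i x)"

definition step_size ::
  "('n::finite \<Rightarrow> 'b::finite) \<Rightarrow> (real^'n \<Rightarrow> real) \<Rightarrow> (real^'n \<Rightarrow> real^'n) \<Rightarrow>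
   ('b \<Rightarrow> real^'n \<Rightarrow> ereal) \<Rightarrow> real \<Rightarrow> real \<Rightarrow> real^'n \<Rightarrow> 'b \<Rightarrow> real^'n \<Rightarrow> real" where
  "step_size blk f gradf \<psi> \<beta> \<gamma> x i d =
     (GREATEST \<alpha>. (\<exists>j::nat. \<alpha> = \<beta> ^ j) \<and>
        objective blk f \<psi> (x + \<alpha> *\<^sub>R d)
          \<le> objective blk f \<psi> x + ereal (\<alpha> * \<gamma>) * Delta blk gradf \<psi> x i d)"

text \<open>
  The state of the algorithm after \<open>k\<close> iterations is determined by the history
  \<open>h = [i_(k-1), \<dots>, i_0]\<close> of the sampled blocks, listed with the most recent one first.
  The quantities chosen at iteration \<open>k\<close> may depend on the whole past and are therefore
  functions of \<open>h\<close>: \<open>d h i\<close> is the direction that would be used if \<open>i\<close> were sampled next.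
\<close>

primrec iterate ::
  "('n::finite \<Rightarrow> 'b::finite) \<Rightarrow> (real^'n \<Rightarrow> real) \<Rightarrow> (real^'n \<Rightarrow> real^'n) \<Rightarrow>
   ('b \<Rightarrow> real^'n \<Rightarrow> ereal) \<Rightarrow> real \<Rightarrow> real \<Rightarrow> ('b list \<Rightarrow> 'b \<Rightarrow> real^'n) \<Rightarrow> real^'n \<Rightarrow>
   'b list \<Rightarrow> real^'n" where
  "iterate blk f gradf \<psi> \<beta> \<gamma> d x0 [] = x0"
| "iterate blk f gradf \<psi> \<beta> \<gamma> d x0 (i # h) =
     (let x = iterate blk f gradf \<psi> \<beta> \<gamma> d x0 h
      in x + step_size blk f gradf \<psi> \<beta> \<gamma> x i (d h i) *\<^sub>R d h i)"

text \<open>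
  \<open>run_pmf p n h\<close> is the conditional distribution, given the history \<open>h\<close>, of the history
  after \<open>n\<close> further iterations, where \<open>p h'\<close> is the sampling distribution used after \<open>h'\<close>.
\<close>

primrec run_pmf :: "('b list \<Rightarrow> 'b pmf) \<Rightarrow> nat \<Rightarrow> 'b list \<Rightarrow> 'b list pmf" where
  "run_pmf p 0 h = return_pmf h"
| "run_pmf p (Suc n) h =
     bind_pmf (run_pmf p n h) (\<lambda>h'. map_pmf (\<lambda>i. i # h') (p h'))"

end

theory Submission
  imports Defs
begin

text \<open>
  All three rates come from one inequality for a single iteration.  Let \<open>g\<close> be the gap
  \<open>F x - F\<^sup>*\<close> at the current point, \<open>g'\<close> the gap after the step, \<open>v = x - P x\<close> the displacement
  from the projection, and let \<open>w\<^sub>i \<le> p\<^sub>i \<alpha>\<^sub>i\<close> be positive weights with \<open>0 \<le> \<omega> \<le> w\<^sub>i\<close> for all \<open>i\<close>.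
  Then for every \<open>\<theta>\<close> in \<open>[0, 1]\<close>

    \<open>E g' \<le> g - (1 - \<eta>) \<gamma> (\<theta> \<omega> g - (\<theta> \<omega>)\<^sup>2 / 2 \<cdot> \<Sum>\<^sub>i v\<^sub>i \<bullet> H\<^sub>i v\<^sub>i / w\<^sub>i)\<close>,

  which is \<open>expected_decrease\<close>.  Sampling block \<open>i\<close> decreases \<open>F\<close> by at least
  \<open>- \<alpha>\<^sub>i \<gamma> \<Delta>\<^sub>i\<close>, and \<open>\<Delta>\<^sub>i \<le> Q\<^sub>i(d\<^sub>i) \<le> (1 - \<eta>) Q\<^sub>i(e\<^sub>i)\<close> for every competitor \<open>e\<^sub>i\<close>, because
  \<open>d\<^sub>i\<close> is an inexact minimizer of the model \<open>Q\<^sub>i\<close>.  As \<open>Q\<^sub>i(d\<^sub>i) \<le> 0\<close>, its weight \<open>p\<^sub>i \<alpha>\<^sub>i\<close> in the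
  expectation may be lowered to \<open>w\<^sub>i\<close>.  The competitor is
  \<open>e\<^sub>i = - (\<theta> \<omega> / w\<^sub>i) v\<^sub>i\<close>: after weighting with \<open>w\<^sub>i\<close> the first-order terms carry the common
  factor \<open>\<theta> \<omega>\<close>, so they add up to the first-order change of \<open>F\<close> along \<open>- v\<close>, which convexity
  bounds by \<open>- g\<close>.  The factor \<open>1 / w\<^sub>i\<close> survives in the second-order terms only.

  The first part is \<open>w\<^sub>i = p\<^sub>i \<alpha>\<^sub>i\<close> and \<open>\<theta> = 1\<close>.  The other two take \<open>w\<^sub>i\<close> to be \<open>p\<^sub>i\<close> times the
  lower bound on the step size, which follows from the blockwise descent lemma together with
  \<open>\<Delta>\<^sub>i \<le> - d\<^sub>i \<bullet> H\<^sub>i d\<^sub>i / (1 + \<surd>\<eta>)\<close> (\<open>inexact_decrease_rate\<close>).  The quadratic term is then at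
  most \<open>K = \<parallel>P\<^sup>-\<^sup>1 A\<^sup>-\<^sup>1 M\<parallel> R\<^sub>0\<^sup>2\<close>, so that for each \<open>\<theta>\<close> the right-hand side is an affine
  function of \<open>g\<close> whose coefficients are the same for all histories.  Averaging over the
  histories therefore gives the identical recursion for the expected gap \<open>\<delta>\<^sub>k\<close>, still for
  every \<open>\<theta>\<close>, and \<open>\<theta>\<close> may be chosen afterwards as a function of \<open>\<delta>\<^sub>k\<close>.  Write \<open>\<pi>\<close> for the
  smallest of the weights \<open>w\<^sub>i\<close>.  As long as \<open>\<delta>\<^sub>k \<ge> K \<pi>\<close> the choice \<open>\<theta> = 1\<close> contracts by a
  constant factor; below this level \<open>\<theta> = \<delta>\<^sub>k / (K \<pi>)\<close> gives
  \<open>\<delta>\<^sub>k\<^sub>+\<^sub>1 \<le> \<delta>\<^sub>k - (1 - \<eta>) \<gamma> \<delta>\<^sub>k\<^sup>2 / (2 K)\<close>, hence the \<open>1 / k\<close> rate (\<open>recursion_two_phases\<close>).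

  Two facts about extended values underlie all this.  The infimum of \<open>Q\<^sub>i\<close> is finite, since
  otherwise inexact minimality would be vacuous for \<open>\<eta> > 0\<close>; this is derived from the lower
  bound on \<open>F\<close> (\<open>model_value_bounded_below\<close>).  And the set of minimizers is closed, so that the
  projection onto it lands in it (\<open>closed_minimizers\<close>).
\<close>

section \<open>Block vectors and block-diagonal matrices\<close>

lemma sum_if_eq_mult:
  "(\<Sum>k\<in>(UNIV::'n::finite set). (if j = k then c else 0) * g k) = c * (g j :: real)"
  by (subst sum.cong[OF refl, of _ _ "\<lambda>k. if j = k then c * g k else 0"]) auto

lemma block_diag_scalar:
  "block_diag blk (\<lambda>i. c i *\<^sub>R block_id blk i) = (\<chi> j k. if j = k then c (blk j) else 0)"
  by (simp add: block_diag_def block_id_def vec_eq_iff)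

lemma block_diag_scalar_vector_nth:
  "(block_diag blk (\<lambda>i. c i *\<^sub>R block_id blk i) *v x) $ j = c (blk j) * x $ j"
  unfolding block_diag_scalar matrix_vector_mult_def by (simp add: sum_if_eq_mult)

lemma block_diag_scalar_mult_nth:
  "(block_diag blk (\<lambda>i. c i *\<^sub>R block_id blk i) ** A) $ j $ k = c (blk j) * A $ j $ k"
  unfolding block_diag_scalar matrix_matrix_mult_def by (simp add: sum_if_eq_mult)

lemma block_diag_scalar_mult:
  "block_diag blk (\<lambda>i. c i *\<^sub>R block_id blk i) ** block_diag blk A
     = block_diag blk (\<lambda>i. c i *\<^sub>R A i)"
  by (simp add: vec_eq_iff block_diag_scalar_mult_nth) (simp add: block_diag_def)

lemma matrix_inv_block_diag_scalar:
  fixes blk :: "'n::finite \<Rightarrow> 'b"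
  assumes "\<And>i. c i \<noteq> 0"
  shows "matrix_inv (block_diag blk (\<lambda>i. c i *\<^sub>R block_id blk i))
           = block_diag blk (\<lambda>i. inverse (c i) *\<^sub>R block_id blk i)"
    (is "matrix_inv ?A = ?B")
proof -
  have one: "?A ** ?B = mat 1" "?B ** ?A = mat 1"
    using assms by (simp_all add: vec_eq_iff block_diag_scalar_mult_nth)
       (simp_all add: block_diag_scalar mat_def)
  have "?A ** matrix_inv ?A = mat 1 \<and> matrix_inv ?A ** ?A = mat 1"
    unfolding matrix_inv_def by (rule someI) (use one in blast)
  then have "?B = ?B ** (?A ** matrix_inv ?A)" by (simp only: matrix_mul_rid)
  also have "\<dots> = matrix_inv ?A" by (simp only: matrix_mul_assoc one matrix_mul_lid)
  finally show ?thesis ..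
qed

lemma inverse_scalings_mult_block_diag:
  fixes blk :: "'n::finite \<Rightarrow> 'b"
  assumes "\<And>i. a i \<noteq> 0" "\<And>i. b i \<noteq> 0"
  shows "matrix_inv (block_diag blk (\<lambda>i. a i *\<^sub>R block_id blk i))
           ** matrix_inv (block_diag blk (\<lambda>i. b i *\<^sub>R block_id blk i)) ** block_diag blk A
         = block_diag blk (\<lambda>i. (1 / (a i * b i)) *\<^sub>R A i)"
  unfolding matrix_inv_block_diag_scalar[of a, OF assms(1)]
    matrix_inv_block_diag_scalar[of b, OF assms(2)]
  by (simp only: block_diag_scalar_mult scaleR_scaleR)
     (simp add: divide_inverse block_diag_scalar_mult)

text \<open>
  A unit vector of block \<open>i\<close> is an eigenvector with eigenvalue \<open>c i\<close>.  Surjectivity of \<open>blk\<close>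
  says that every block contains such a vector.
\<close>

lemma onorm_block_diag_scalar_ge:
  fixes blk :: "'n::finite \<Rightarrow> 'b"
  assumes "surj blk"
  shows "c i \<le> onorm ((*v) (block_diag blk (\<lambda>i. c i *\<^sub>R block_id blk i)))"
proof -
  obtain j where j: "blk j = i" using assms by (metis surjD)
  let ?A = "block_diag blk (\<lambda>i. c i *\<^sub>R block_id blk i)"
  have "?A *v axis j 1 = c i *\<^sub>R axis j (1::real)"
    by (auto simp: vec_eq_iff block_diag_scalar_vector_nth axis_def j)
  then have "norm (?A *v axis j 1) = \<bar>c i\<bar>" by (simp add: norm_axis_1)
  moreover have "norm (?A *v axis j 1) \<le> onorm ((*v) ?A) * norm (axis j (1::real))"
    by (rule onorm) simp
  ultimately show ?thesis by (simp add: norm_axis_1)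
qed

lemma block_part_in_block_space [simp]: "block_part blk i x \<in> block_space blk i"
  by (simp add: block_part_def block_space_def)

lemma subspace_block_space: "subspace (block_space blk i)"
  by (simp add: subspace_def block_space_def)

lemma block_part_same: "v \<in> block_space blk i \<Longrightarrow> block_part blk i v = v"
  by (auto simp: block_part_def block_space_def vec_eq_iff)

lemma block_part_other: "v \<in> block_space blk i \<Longrightarrow> j \<noteq> i \<Longrightarrow> block_part blk j v = 0"
  by (auto simp: block_part_def block_space_def vec_eq_iff)

lemma linear_block_part: "linear (block_part blk i)"
  by (auto simp: linear_iff block_part_def vec_eq_iff)

lemmas block_part_add = linear_add[OF linear_block_part]
  and block_part_diff = linear_diff[OF linear_block_part]

text \<open>
  The projection onto a block is self-adjoint, so it can be dropped against a vector of the block.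
\<close>

lemma block_part_inner: "v \<in> block_space blk i \<Longrightarrow> block_part blk i x \<bullet> v = x \<bullet> v"
  unfolding inner_vec_def block_space_def block_part_def by (auto intro!: sum.cong)

lemma sum_block_parts: "(\<Sum>i\<in>(UNIV::'b::finite set). block_part blk i x) = x"
  by (simp add: vec_eq_iff block_part_def)

lemma inner_sum_blocks:
  "(\<Sum>i\<in>(UNIV::'b::finite set). block_part blk i x \<bullet> block_part blk i y) = x \<bullet> y"
  by (subst (2) sum_block_parts[of blk y, symmetric])
     (simp add: block_part_inner inner_sum_right)

lemma block_diag_quadratic:
  fixes blk :: "'n::finite \<Rightarrow> 'b::finite"
  assumes "\<And>i. block_matrix blk i (A i)"
  shows "v \<bullet> (block_diag blk A *v v)
           = (\<Sum>i\<in>UNIV. block_part blk i v \<bullet> (A i *v block_part blk i v))"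
proof -
  have z: "A i $ j $ k = 0" if "blk j \<noteq> i \<or> blk k \<noteq> i" for i j k
    using assms that by (auto simp: block_matrix_def)
  have "block_part blk i (block_diag blk A *v v) = A i *v block_part blk i v" for i
    using z by (auto simp: vec_eq_iff block_part_def matrix_vector_mult_def block_diag_def
        intro!: sum.cong sum.neutral)
  then show ?thesis by (simp flip: inner_sum_blocks[of blk v])
qed

lemma loewner_ge_quadratic: "A \<succeq> B \<Longrightarrow> v \<bullet> (B *v v) \<le> v \<bullet> (A *v v)"
  by (auto simp: loewner_ge_def psd_def matrix_vector_mult_diff_rdistrib inner_diff_right)

lemma block_id_quadratic:
  assumes "v \<in> block_space blk i"
  shows "v \<bullet> ((c *\<^sub>R block_id blk i) *v v) = c * (norm v)\<^sup>2"
proof -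
  have "(c *\<^sub>R block_id blk i) *v v = c *\<^sub>R v"
  proof -
    have "((c *\<^sub>R block_id blk i) *v v) $ j = c * v $ j" for j
    proof -
      have "((c *\<^sub>R block_id blk i) *v v) $ j
          = (\<Sum>k\<in>UNIV. (if j = k then (if blk j = i then c else 0) else 0) * v $ k)"
        unfolding matrix_vector_mult_def block_id_def by (auto intro!: sum.cong)
      also have "\<dots> = (if blk j = i then c else 0) * v $ j" by (rule sum_if_eq_mult)
      finally show ?thesis using assms by (auto simp: block_space_def)
    qed
    then show ?thesis by (simp add: vec_eq_iff)
  qed
  then show ?thesis by (simp add: power2_norm_eq_inner)
qed


section \<open>Lower semicontinuity of extended-valued sums\<close>

text \<open>
  Lower semicontinuity is expressed through open superlevel sets at real levels.  The sum
  exceeds \<open>t\<close> exactly if \<open>g\<close> exceeds some real \<open>a\<close> and \<open>h\<close> exceeds \<open>t - a\<close>; the value \<open>-\<infinity>\<close> is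
  excluded because \<open>\<infinity> + (-\<infinity>) = \<infinity>\<close>.
\<close>

lemma open_superlevel_add:
  fixes g h :: "'a::topological_space \<Rightarrow> ereal"
  assumes g: "\<And>t. open {x. ereal t < g x}" "\<And>x. g x \<noteq> -\<infinity>"
    and h: "\<And>t. open {x. ereal t < h x}" "\<And>x. h x \<noteq> -\<infinity>"
  shows "open {x. ereal t < g x + h x}"
proof -
  have "\<exists>a. ereal a < g x \<and> ereal (t - a) < h x" if "ereal t < g x + h x" for x
  proof (cases "g x" "h x" rule: ereal2_cases)
    case (real_real a b)
    then have "t - b < a" using that by simp
    then obtain s where "t - b < s" "s < a" using dense by blast
    then show ?thesis using real_real by (intro exI[of _ s]) auto
  next
    case (real_PInf a)
    then show ?thesis by (intro exI[of _ "a - 1"]) auto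
  next
    case (PInf_real b)
    then show ?thesis by (intro exI[of _ "t - b + 1"]) auto
  qed (use g h in auto)
  moreover have "ereal t < g x + h x" if "ereal a < g x" "ereal (t - a) < h x" for a x
    using that g(2)[of x] h(2)[of x] by (cases "g x"; cases "h x") auto
  ultimately have "{x. ereal t < g x + h x}
      = (\<Union>a. {x. ereal a < g x} \<inter> {x. ereal (t - a) < h x})"
    by blast
  then show ?thesis using g h by (auto intro!: open_UN open_Int)
qed

lemma open_superlevel_sum:
  fixes g :: "'i \<Rightarrow> 'a::topological_space \<Rightarrow> ereal"
  assumes "finite I" "\<And>i t. open {x. ereal t < g i x}" "\<And>i x. g i x \<noteq> -\<infinity>"
  shows "open {x. ereal t < (\<Sum>i\<in>I. g i x)}"
  using assms(1)
proof (induction I arbitrary: t)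
  case (insert i I)
  have "(\<Sum>i\<in>I. g i x) \<noteq> -\<infinity>" for x
    using insert(1) by (induction rule: finite_induct) (auto simp: assms(3))
  then have "open {x. ereal t < g i x + (\<Sum>i\<in>I. g i x)}"
    by (intro open_superlevel_add insert.IH assms)
  then show ?case using insert by simp
qed simp

section \<open>Gradients and tangents\<close>

lemma GDERIV_imp_DERIV_line:
  assumes "GDERIV f (x + t *\<^sub>R v) :> g"
  shows "((\<lambda>t. f (x + t *\<^sub>R v)) has_real_derivative g \<bullet> v) (at t)"
proof -
  have "((\<lambda>t. x + t *\<^sub>R v) has_derivative (\<lambda>s. s *\<^sub>R v)) (at t)"
    by (auto intro!: derivative_eq_intros)
  moreover have "(f has_derivative (\<lambda>h. h \<bullet> g)) (at (x + t *\<^sub>R v))"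
    using assms by (simp add: gderiv_def)
  ultimately have "((\<lambda>t. f (x + t *\<^sub>R v)) has_derivative (\<lambda>s. (s *\<^sub>R v) \<bullet> g)) (at t)"
    by (rule has_derivative_compose)
  then show ?thesis
    by (rule has_derivative_imp_has_field_derivative) (simp add: inner_commute)
qed

text \<open>
  Restricting \<open>f\<close> to the line through \<open>x\<close> and \<open>y\<close> reduces the claim to one variable.
\<close>

lemma convex_on_above_tangent:
  assumes "convex_on UNIV f" "GDERIV f x :> g"
  shows "f x + g \<bullet> (y - x) \<le> f y"
proof -
  let ?\<phi> = "\<lambda>t::real. f (x + t *\<^sub>R (y - x))"
  have "convex_on UNIV ?\<phi>"
  proof (rule convex_onI)
    fix t s r :: real assume "0 < t" "t < 1"
    then show "?\<phi> ((1 - t) *\<^sub>R s + t *\<^sub>R r) \<le> (1 - t) * ?\<phi> s + t * ?\<phi> r"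
      using convex_onD[OF assms(1), of t "x + s *\<^sub>R (y - x)" "x + r *\<^sub>R (y - x)"]
      by (simp add: algebra_simps)
  qed auto
  moreover have "(?\<phi> has_real_derivative g \<bullet> (y - x)) (at 0)"
    using GDERIV_imp_DERIV_line[of f x 0 "y - x" g] assms(2) by simp
  ultimately have "?\<phi> 1 - ?\<phi> 0 \<ge> g \<bullet> (y - x) * (1 - 0)"
    by (intro convex_on_imp_above_tangent[of UNIV]) auto
  then show ?thesis by simp
qed

section \<open>The composite objective\<close>

locale composite_problem =
  fixes blk :: "'n::finite \<Rightarrow> 'b::finite"
    and f :: "real^'n \<Rightarrow> real"
    and gradf :: "real^'n \<Rightarrow> real^'n"
    and \<psi> :: "'b \<Rightarrow> real^'n \<Rightarrow> ereal"
    and L :: "'b \<Rightarrow> real"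
  assumes gradient: "\<And>x. GDERIV f x :> gradf x"
    and L_pos: "\<And>i. L i > 0"
    and block_lipschitz: "\<And>i x v. v \<in> block_space blk i \<Longrightarrow>
          norm (block_part blk i (gradf (x + v)) - block_part blk i (gradf x)) \<le> L i * norm v"
    and f_convex: "convex_on UNIV f"
    and psi: "\<And>i. proper_closed_convex (block_space blk i) (\<psi> i)"
begin

abbreviation "F \<equiv> objective blk f \<psi>"
abbreviation "blockpart \<equiv> block_part blk"
abbreviation "blockspace \<equiv> block_space blk"

text \<open>
  On the domain of \<open>F\<close> everything is real.  The following are the real counterparts of
  \<open>\<psi> i\<close>, \<open>objective\<close>, \<open>Delta\<close> and \<open>model\<close>; each agrees with the extended-valued original at points
  where the \<open>\<psi>\<close>-terms are finite.
\<close>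

definition psi_value :: "'b \<Rightarrow> real^'n \<Rightarrow> real" where
  "psi_value i v = real_of_ereal (\<psi> i v)"

definition F_value :: "real^'n \<Rightarrow> real" where
  "F_value x = f x + (\<Sum>i\<in>UNIV. psi_value i (blockpart i x))"

definition Delta_value :: "real^'n \<Rightarrow> 'b \<Rightarrow> real^'n \<Rightarrow> real" where
  "Delta_value x i d = blockpart i (gradf x) \<bullet> d
      + psi_value i (blockpart i x + d) - psi_value i (blockpart i x)"

definition model_value :: "real^'n \<Rightarrow> 'b \<Rightarrow> real^'n^'n \<Rightarrow> real^'n \<Rightarrow> real" where
  "model_value x i A d = Delta_value x i d + d \<bullet> (A *v d) / 2"

lemma psi_eq_value: "v \<in> blockspace i \<Longrightarrow> \<psi> i v < \<infinity> \<Longrightarrow> \<psi> i v = ereal (psi_value i v)"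
  using psi[of i] by (cases "\<psi> i v") (auto simp: proper_closed_convex_def psi_value_def)

lemma psi_blockpart_not_MInf [simp]: "\<psi> i (blockpart i x) \<noteq> -\<infinity>"
  using psi[of i] by (auto simp: proper_closed_convex_def)

lemma F_finite_iff: "F x < \<infinity> \<longleftrightarrow> (\<forall>i. \<psi> i (blockpart i x) < \<infinity>)"
proof -
  have "F x = \<infinity> \<longleftrightarrow> (\<Sum>i\<in>UNIV. \<psi> i (blockpart i x)) = \<infinity>"
    by (cases "\<Sum>i\<in>UNIV. \<psi> i (blockpart i x)") (auto simp: objective_def)
  then show ?thesis by (auto simp: sum_Pinfty less_top[symmetric] top_ereal_def)
qed

lemma psi_blockpart_finite: "F x < \<infinity> \<Longrightarrow> \<psi> i (blockpart i x) < \<infinity>"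
  using F_finite_iff by blast

lemma F_eq_value: "F x < \<infinity> \<Longrightarrow> F x = ereal (F_value x)"
proof -
  assume "F x < \<infinity>"
  then have "\<psi> i (blockpart i x) = ereal (psi_value i (blockpart i x))" for i
    using psi_eq_value F_finite_iff by simp
  then show ?thesis by (simp only: objective_def F_value_def sum_ereal plus_ereal.simps)
qed

text \<open>
  Convexity of the epigraph, read at its lowest points.
\<close>

lemma psi_convex:
  assumes "u \<in> blockspace i" "v \<in> blockspace i" "\<psi> i u < \<infinity>" "\<psi> i v < \<infinity>" "0 \<le> t" "t \<le> 1"
  shows "\<psi> i ((1 - t) *\<^sub>R u + t *\<^sub>R v) < \<infinity>"
    and "psi_value i ((1 - t) *\<^sub>R u + t *\<^sub>R v) \<le> (1 - t) * psi_value i u + t * psi_value i v"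
proof -
  let ?E = "ereal_epigraph (blockspace i) (\<psi> i)"
  have "convex ?E" using psi[of i] by (simp add: proper_closed_convex_def)
  moreover have "(u, psi_value i u) \<in> ?E" "(v, psi_value i v) \<in> ?E"
    using assms psi_eq_value by (auto simp: ereal_epigraph_def)
  ultimately have "(1 - t) *\<^sub>R (u, psi_value i u) + t *\<^sub>R (v, psi_value i v) \<in> ?E"
    using assms by (intro convexD_alt) auto
  then have *: "(1 - t) *\<^sub>R u + t *\<^sub>R v \<in> blockspace i"
    "\<psi> i ((1 - t) *\<^sub>R u + t *\<^sub>R v) \<le> ereal ((1 - t) * psi_value i u + t * psi_value i v)"
    by (auto simp: ereal_epigraph_def)
  then show 1: "\<psi> i ((1 - t) *\<^sub>R u + t *\<^sub>R v) < \<infinity>" by (auto intro: le_less_trans)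
  show "psi_value i ((1 - t) *\<^sub>R u + t *\<^sub>R v) \<le> (1 - t) * psi_value i u + t * psi_value i v"
    using *(2) psi_eq_value[OF *(1) 1] by simp
qed

lemma open_superlevel_psi: "open {x. ereal t < \<psi> i (blockpart i x)}"
proof -
  have "closed ((\<lambda>x. (blockpart i x, t)) -` ereal_epigraph (blockspace i) (\<psi> i))"
    using psi[of i] by (intro closed_vimage)
      (auto simp: proper_closed_convex_def linear_continuous_on linear_conv_bounded_linear[symmetric]
        linear_block_part intro!: continuous_intros)
  moreover have "{x. ereal t < \<psi> i (blockpart i x)}
      = - ((\<lambda>x. (blockpart i x, t)) -` ereal_epigraph (blockspace i) (\<psi> i))"
    by (auto simp: ereal_epigraph_def)
  ultimately show ?thesis by auto
qed

lemma continuous_f: "continuous_on UNIV f"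
  using gradient by (auto simp: gderiv_def continuous_on_eq_continuous_at intro: has_derivative_continuous)

lemma open_superlevel_F: "open {x. ereal t < F x}"
proof -
  have f: "open {x. ereal s < ereal (f x)}" for s
    using open_Collect_less[OF continuous_on_const continuous_f, of s] by simp
  have "(\<Sum>i\<in>I. \<psi> i (blockpart i x)) \<noteq> -\<infinity>" if "finite I" for I x
    using that by (induction rule: finite_induct) auto
  then show ?thesis
    unfolding objective_def
    by (intro open_superlevel_add open_superlevel_sum open_superlevel_psi f) auto
qed

text \<open>
  The minimizers form a sublevel set of \<open>F\<close>, at the level of any one of them.
\<close>

lemma closed_minimizers:
  assumes "z \<in> minimizers F" "F z < \<infinity>"
  shows "closed (minimizers F)"
proof -
  have "minimizers F = - {x. ereal (F_value z) < F x}"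
  proof -
    have "(\<forall>y. F x \<le> F y) \<longleftrightarrow> F x \<le> F z" for x
      using assms(1) order_trans unfolding minimizers_def by blast
    then show ?thesis
      unfolding minimizers_def F_eq_value[OF assms(2), symmetric] by (auto simp: not_less)
  qed
  then show ?thesis using open_superlevel_F[of "F_value z"] by auto
qed

section \<open>Moving a single block\<close>

lemma F_block_step:
  assumes "F x < \<infinity>" "d \<in> blockspace i" "\<psi> i (blockpart i x + d) < \<infinity>"
  shows "F (x + d) < \<infinity>"
    and "F_value (x + d) = F_value x + (f (x + d) - f x)
      + psi_value i (blockpart i x + d) - psi_value i (blockpart i x)"
proof -
  have same: "blockpart i (x + d) = blockpart i x + d"
    using assms by (simp add: block_part_add block_part_same)
  have other: "blockpart j (x + d) = blockpart j x" if "j \<noteq> i" for j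
    using assms that by (simp add: block_part_add block_part_other)
  show "F (x + d) < \<infinity>"
    unfolding F_finite_iff
  proof
    fix j show "\<psi> j (blockpart j (x + d)) < \<infinity>"
      using assms same other F_finite_iff by (cases "j = i") simp_all
  qed
  show "F_value (x + d) = F_value x + (f (x + d) - f x)
      + psi_value i (blockpart i x + d) - psi_value i (blockpart i x)"
  proof -
    have rest: "(\<Sum>j\<in>UNIV - {i}. psi_value j (blockpart j (x + d)))
        = (\<Sum>j\<in>UNIV - {i}. psi_value j (blockpart j x))"
      by (intro sum.cong) (auto simp: other)
    have split: "(\<Sum>j\<in>UNIV. g j) = g i + (\<Sum>j\<in>UNIV - {i}. g j)" for g :: "'b \<Rightarrow> real"
      by (rule sum.remove) auto
    show ?thesis
      using split[of "\<lambda>j. psi_value j (blockpart j (x + d))"]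
        split[of "\<lambda>j. psi_value j (blockpart j x)"]
      unfolding F_value_def rest same by linarith
  qed
qed

lemma Delta_value_zero: "Delta_value x i 0 = 0" by (simp add: Delta_value_def)

text \<open>
  The linear part of \<open>Delta_value\<close> is homogeneous and its \<open>\<psi>\<close>-part is convex and vanishes at the
  origin; this is what makes it profitable to shorten a competitor.
\<close>

lemma Delta_value_scale:
  assumes "F x < \<infinity>" "d \<in> blockspace i" "\<psi> i (blockpart i x + d) < \<infinity>" "0 \<le> t" "t \<le> 1"
  shows "\<psi> i (blockpart i x + t *\<^sub>R d) < \<infinity>" "Delta_value x i (t *\<^sub>R d) \<le> t * Delta_value x i d"
proof -
  have e: "blockpart i x + t *\<^sub>R d = (1 - t) *\<^sub>R blockpart i x + t *\<^sub>R (blockpart i x + d)"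
    by (simp add: algebra_simps)
  have "blockpart i x + d \<in> blockspace i"
    using assms by (auto intro: subspace_add[OF subspace_block_space])
  note * = psi_convex[OF block_part_in_block_space this psi_blockpart_finite[OF assms(1)] assms(3-5),
      folded e]
  show "\<psi> i (blockpart i x + t *\<^sub>R d) < \<infinity>" by (rule *)
  have "psi_value i (blockpart i x + t *\<^sub>R d)
      \<le> (1 - t) * psi_value i (blockpart i x) + t * psi_value i (blockpart i x + d)"
    by (rule *)
  then show "Delta_value x i (t *\<^sub>R d) \<le> t * Delta_value x i d"
    by (simp add: Delta_value_def algebra_simps)
qed

lemma model_value_scale:
  assumes "F x < \<infinity>" "d \<in> blockspace i" "\<psi> i (blockpart i x + d) < \<infinity>" "0 \<le> t" "t \<le> 1"
  shows "model_value x i A (t *\<^sub>R d) \<le> t * Delta_value x i d + t\<^sup>2 * (d \<bullet> (A *v d)) / 2"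
  using Delta_value_scale[OF assms] by (simp add: model_value_def matrix_vector_mult_scaleR power2_eq_square)

text \<open>
  The difference of the two sides vanishes at \<open>t = 0\<close>.  Its derivative is at most zero, by the
  Lipschitz bound for block \<open>i\<close>: along \<open>d\<close> only block \<open>i\<close> of the gradient matters.
\<close>

lemma block_descent:
  assumes d: "d \<in> blockspace i" and t: "0 \<le> t"
  shows "f (x + t *\<^sub>R d) \<le> f x + t * (gradf x \<bullet> d) + L i * t\<^sup>2 / 2 * (norm d)\<^sup>2"
proof -
  let ?\<phi> = "\<lambda>t. f (x + t *\<^sub>R d) - t * (gradf x \<bullet> d) - L i * t\<^sup>2 / 2 * (norm d)\<^sup>2"
  have "?\<phi> t \<le> ?\<phi> 0"
  proof (rule DERIV_nonpos_imp_nonincreasing[OF t])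
    fix s assume s: "0 \<le> s" "s \<le> t"
    have sd: "s *\<^sub>R d \<in> blockspace i" using d by (rule subspace_scale[OF subspace_block_space])
    have "(?\<phi> has_real_derivative
        gradf (x + s *\<^sub>R d) \<bullet> d - gradf x \<bullet> d - L i * s * (norm d)\<^sup>2) (at s)"
      by (auto intro!: derivative_eq_intros GDERIV_imp_DERIV_line gradient)
    moreover have "gradf (x + s *\<^sub>R d) \<bullet> d - gradf x \<bullet> d
        = (blockpart i (gradf (x + s *\<^sub>R d)) - blockpart i (gradf x)) \<bullet> d"
      using d by (simp add: inner_diff_left block_part_inner)
    moreover have "\<dots> \<le> L i * norm (s *\<^sub>R d) * norm d"
      by (rule order_trans[OF norm_cauchy_schwarz])
         (intro mult_right_mono block_lipschitz sd norm_ge_zero)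
    ultimately show "\<exists>y. (?\<phi> has_real_derivative y) (at s) \<and> y \<le> 0"
      using s by (auto simp: power2_eq_square mult.assoc)
  qed
  then show ?thesis by simp
qed

lemma F_value_block_descent:
  assumes "F x < \<infinity>" "d \<in> blockspace i" "\<psi> i (blockpart i x + d) < \<infinity>" "0 \<le> t" "t \<le> 1"
  shows "F (x + t *\<^sub>R d) < \<infinity>"
    and "F_value (x + t *\<^sub>R d) \<le> F_value x + t * Delta_value x i d + L i * t\<^sup>2 / 2 * (norm d)\<^sup>2"
proof -
  have td: "t *\<^sub>R d \<in> blockspace i" using assms(2) by (rule subspace_scale[OF subspace_block_space])
  note s = F_block_step[OF assms(1) td Delta_value_scale(1)[OF assms]]
  show "F (x + t *\<^sub>R d) < \<infinity>" by (rule s)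
  show "F_value (x + t *\<^sub>R d) \<le> F_value x + t * Delta_value x i d + L i * t\<^sup>2 / 2 * (norm d)\<^sup>2"
    using s(2) Delta_value_scale(2)[OF assms] block_descent[OF assms(2,4), of x]
      block_part_inner[OF assms(2), of "gradf x"]
    by (simp add: Delta_value_def)
qed

section \<open>Inexact minimizers of the block model\<close>

lemma Delta_eq_value:
  assumes "F x < \<infinity>" "d \<in> blockspace i" "\<psi> i (blockpart i x + d) < \<infinity>"
  shows "Delta blk gradf \<psi> x i d = ereal (Delta_value x i d)"
proof -
  have "blockpart i x + d \<in> blockspace i"
    using assms by (auto intro: subspace_add[OF subspace_block_space])
  then have "\<psi> i (blockpart i x + d) = ereal (psi_value i (blockpart i x + d))"
    using psi_eq_value assms(3) by blast
  moreover have "\<psi> i (blockpart i x) = ereal (psi_value i (blockpart i x))"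
    using psi_eq_value assms(1) F_finite_iff by simp
  ultimately show ?thesis by (simp add: Delta_def Delta_value_def)
qed

lemma model_eq_value:
  assumes "F x < \<infinity>" "d \<in> blockspace i"
  shows "model blk gradf \<psi> A x i d = (if \<psi> i (blockpart i x + d) < \<infinity>
      then ereal (model_value x i A d) else \<infinity>)"
proof -
  have s: "blockpart i x + d \<in> blockspace i"
    using assms by (auto intro: subspace_add[OF subspace_block_space])
  have "\<psi> i (blockpart i x) = ereal (psi_value i (blockpart i x))"
    using psi_eq_value assms(1) F_finite_iff by simp
  then show ?thesis using psi_eq_value[OF s]
    by (auto simp: model_def model_value_def Delta_value_def not_less)
qed

text \<open>
  If \<open>\<mu> < L i\<close>, the curvature of the model can be smaller than that of \<open>f\<close>, and the model at \<open>d\<close>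
  cannot be compared with \<open>F (x + d)\<close> directly.  It can be compared with \<open>F (x + t d)\<close> when
  \<open>t \<le> \<mu> / L i\<close>: shortening \<open>d\<close> scales the first-order part by \<open>t\<close> but the error of the descent
  lemma by \<open>t\<^sup>2\<close>.
\<close>

lemma model_value_bounded_below:
  assumes x: "F x < \<infinity>" and d: "d \<in> blockspace i" "\<psi> i (blockpart i x + d) < \<infinity>"
    and A: "\<mu> > 0" "\<And>v. v \<in> blockspace i \<Longrightarrow> \<mu> * (norm v)\<^sup>2 \<le> v \<bullet> (A *v v)"
    and c: "\<And>y. ereal c \<le> F y"
  shows "model_value x i A d \<ge> (c - F_value x) / min 1 (\<mu> / L i)"
proof -
  define t where "t = min 1 (\<mu> / L i)"
  have t: "0 < t" "t \<le> 1" "L i * t \<le> \<mu>"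
    using L_pos[of i] A(1) by (auto simp: t_def field_simps min_def)
  note s = F_value_block_descent[OF x d, of t]
  have "c \<le> F_value (x + t *\<^sub>R d)"
    using c[of "x + t *\<^sub>R d"] F_eq_value[OF s(1)] t by simp
  then have "c - F_value x \<le> t * Delta_value x i d + L i * t\<^sup>2 / 2 * (norm d)\<^sup>2" using s(2) t by simp
  also have "\<dots> = t * (Delta_value x i d + (L i * t) * (norm d)\<^sup>2 / 2)"
    by (simp add: algebra_simps power2_eq_square)
  also have "\<dots> \<le> t * model_value x i A d"
  proof (intro mult_left_mono)
    have "(L i * t) * (norm d)\<^sup>2 \<le> \<mu> * (norm d)\<^sup>2" using t by (intro mult_right_mono) auto
    then show "Delta_value x i d + (L i * t) * (norm d)\<^sup>2 / 2 \<le> model_value x i A d"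
      using A(2)[OF d(1)] by (simp add: model_value_def)
  qed (use t in simp)
  finally show ?thesis unfolding t_def[symmetric] using t by (simp add: pos_divide_le_eq mult.commute)
qed

text \<open>
  With \<open>Q(0) = 0\<close>, being an \<open>\<eta>\<close>-approximate minimizer means \<open>Q(d) \<le> (1 - \<eta>) inf Q\<close> once the
  infimum is finite.  In terms of competitors \<open>e\<close> the infimum no longer appears.
\<close>

lemma approx_minimizer_contraction:
  assumes x: "F x < \<infinity>"
    and A: "\<mu> > 0" "\<And>v. v \<in> blockspace i \<Longrightarrow> \<mu> * (norm v)\<^sup>2 \<le> v \<bullet> (A *v v)"
    and c: "\<And>y. ereal c \<le> F y" and \<eta>: "0 \<le> \<eta>" "\<eta> < 1"
    and d: "approx_minimizer \<eta> (blockspace i) (model blk gradf \<psi> A x i) d"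
  shows "d \<in> blockspace i" "\<psi> i (blockpart i x + d) < \<infinity>"
    and "\<And>e. e \<in> blockspace i \<Longrightarrow> \<psi> i (blockpart i x + e) < \<infinity> \<Longrightarrow>
           model_value x i A d \<le> (1 - \<eta>) * model_value x i A e"
proof -
  let ?Q = "model blk gradf \<psi> A x i"
  define q where "q = (INF v\<in>blockspace i. ?Q v)"
  have zero: "0 \<in> blockspace i" by (rule subspace_0[OF subspace_block_space])
  show db: "d \<in> blockspace i" using d by (simp add: approx_minimizer_def)
  have Q0: "?Q 0 = 0"
    using model_eq_value[OF x zero] psi_blockpart_finite[OF x, of i]
    by (simp add: model_value_def Delta_value_zero zero_ereal_def)
  have "q \<le> 0" unfolding q_def using zero Q0 by (metis INF_lower)
  moreover have "ereal ((c - F_value x) / min 1 (\<mu> / L i)) \<le> q"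
    unfolding q_def using model_value_bounded_below[OF x _ _ A c] model_eq_value[OF x]
    by (intro INF_greatest) auto
  ultimately obtain q' where q': "q = ereal q'" by (cases q) auto
  have "?Q d - q \<le> ereal \<eta> * (?Q 0 - q)"
    using d by (simp add: approx_minimizer_def q_def)
  then have *: "?Q d - ereal q' \<le> ereal (- \<eta> * q')" by (simp add: Q0 q' zero_ereal_def)
  then show df: "\<psi> i (blockpart i x + d) < \<infinity>"
    using model_eq_value[OF x db] by (auto split: if_splits)
  have "model_value x i A d \<le> (1 - \<eta>) * q'"
    using * model_eq_value[OF x db] df by (simp add: algebra_simps)
  moreover fix e assume e: "e \<in> blockspace i" "\<psi> i (blockpart i x + e) < \<infinity>"
  have "q \<le> ?Q e" unfolding q_def using e(1) by (rule INF_lower)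
  then have "q' \<le> model_value x i A e" using model_eq_value[OF x e(1)] e(2) q' by simp
  then have "(1 - \<eta>) * q' \<le> (1 - \<eta>) * model_value x i A e" using \<eta> by (intro mult_left_mono) auto
  ultimately show "model_value x i A d \<le> (1 - \<eta>) * model_value x i A e" by simp
qed

end

text \<open>
  This is applied with \<open>D = d \<bullet> H d\<close>, the assumption being the comparison of \<open>d\<close> with the
  competitors \<open>t d\<close>.  It says \<open>(1 - (1 - \<eta>) t) \<Delta> \<le> - (1 - (1 - \<eta>) t\<^sup>2) D / 2\<close>, and the best value is
  \<open>t = 1 / (1 + \<surd>\<eta>)\<close>.  For \<open>\<eta> = 0\<close> this is \<open>t = 1\<close>, where the inequality is void, and the bound
  is obtained as the limit \<open>t \<rightarrow> 1\<close>.
\<close>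

lemma inexact_decrease_rate:
  fixes \<Delta> D \<eta> :: real
  assumes \<eta>: "0 \<le> \<eta>" "\<eta> < 1" and D: "0 \<le> D"
    and rate: "\<And>t. 0 \<le> t \<Longrightarrow> t \<le> 1 \<Longrightarrow> \<Delta> + D / 2 \<le> (1 - \<eta>) * (t * \<Delta> + t\<^sup>2 * D / 2)"
  shows "\<Delta> \<le> - D / (1 + sqrt \<eta>)"
proof (cases "\<eta> = 0")
  case True
  have bound: "\<Delta> \<le> - (1 + t) / 2 * D" if "0 \<le> t" "t < 1" for t
  proof -
    have "(1 - t) * \<Delta> \<le> (1 - t) * (- (1 + t) / 2 * D)"
      using rate[of t] that True by (simp add: algebra_simps power2_eq_square)
    then show ?thesis using that by (simp add: mult_le_cancel_left_pos)
  qed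
  \<comment> \<open>The loss is at most \<open>(1 - t) D / 2\<close>; the \<open>+ 1\<close> in the choice of \<open>t = 1 - s\<close> covers \<open>D = 0\<close>.\<close>
  have "\<Delta> \<le> - D + e" if e: "e > 0" for e
  proof -
    define s where "s = min 1 (e / (D + 1))"
    have s: "0 < s" "s \<le> 1" using e D by (auto simp: s_def)
    have "s * D \<le> e / (D + 1) * D" using D by (intro mult_right_mono) (auto simp: s_def)
    also have "\<dots> \<le> e" using e D by (simp add: field_simps)
    finally show ?thesis using bound[of "1 - s"] s e by (simp add: algebra_simps)
  qed
  then show ?thesis using True by (simp add: field_le_epsilon)
next
  case False
  define s where "s = sqrt \<eta>"
  have s: "0 < s" "s < 1" "\<eta> = s\<^sup>2" using \<eta> False by (auto simp: s_def real_sqrt_lt_1_iff)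
  define u where "u = 1 / (1 + s)"
  have u: "0 < u" "u \<le> 1" "(1 + s) * u = 1" using s by (auto simp: u_def)
  have "(1 - \<eta>) * u = (1 - s) * ((1 + s) * u)" by (simp add: s(3) power2_eq_square algebra_simps)
  then have au: "(1 - \<eta>) * u = 1 - s" using u by simp
  have "(1 - \<eta>) * (u * \<Delta> + u\<^sup>2 * D / 2) = ((1 - \<eta>) * u) * (\<Delta> + u * D / 2)"
    by (simp add: algebra_simps power2_eq_square)
  then have "\<Delta> + D / 2 \<le> (1 - s) * (\<Delta> + u * D / 2)" using rate[of u] u au by simp
  also have "\<dots> = \<Delta> - s * \<Delta> + ((1 - s) * u) * D / 2" by (simp add: algebra_simps)
  also have "(1 - s) * u = 1 - 2 * (s * u)" using u(3) by (simp add: algebra_simps)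
  also have "(1 - 2 * (s * u)) * D / 2 = D / 2 - s * (u * D)"
    by (simp add: diff_divide_distrib left_diff_distrib)
  finally have "s * \<Delta> \<le> s * (- u * D)" by (simp add: mult_ac)
  then have "\<Delta> \<le> - u * D" using s(1) by (rule mult_left_le_imp_le)
  then show ?thesis unfolding u_def s_def by simp
qed

section \<open>Backtracking line search\<close>

context composite_problem begin

text \<open>
  Since \<open>\<kappa> \<parallel>d\<parallel>\<^sup>2 \<le> - \<Delta>\<close>, the quadratic error in the descent lemma is absorbed by a fraction of
  \<open>- t \<Delta>\<close> for every \<open>t\<close> in \<open>[0, 1]\<close> with \<open>t \<le> 2 (1 - \<gamma>) \<kappa> / L i\<close>, so all these steps are
  accepted.  Hence backtracking stops, and unless it accepts the full step, the previous,
  rejected trial step \<open>\<alpha> / \<beta>\<close> was larger than this threshold.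
\<close>

lemma backtracking_step:
  assumes x: "F x < \<infinity>" and d: "d \<in> blockspace i" "\<psi> i (blockpart i x + d) < \<infinity>"
    and \<beta>: "0 < \<beta>" "\<beta> < 1" and \<gamma>: "0 < \<gamma>" "\<gamma> < 1"
    and \<kappa>: "0 < \<kappa>" "\<kappa> * (norm d)\<^sup>2 \<le> - Delta_value x i d"
  defines "\<alpha> \<equiv> step_size blk f gradf \<psi> \<beta> \<gamma> x i d"
  shows "0 < \<alpha>" "\<alpha> \<le> 1" "min 1 (2 * \<beta> * (1 - \<gamma>) * \<kappa> / L i) \<le> \<alpha>"
    and "F (x + \<alpha> *\<^sub>R d) < \<infinity>" "F_value (x + \<alpha> *\<^sub>R d) \<le> F_value x + \<alpha> * \<gamma> * Delta_value x i d"
proof -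
  define a where "a = 2 * (1 - \<gamma>) * \<kappa> / L i"
  have a: "a > 0" using L_pos[of i] \<gamma> \<kappa> by (simp add: a_def)
  define ok where "ok t \<longleftrightarrow> objective blk f \<psi> (x + t *\<^sub>R d)
      \<le> objective blk f \<psi> x + ereal (t * \<gamma>) * Delta blk gradf \<psi> x i d" for t
  have ok_iff: "ok t \<longleftrightarrow> F_value (x + t *\<^sub>R d) \<le> F_value x + t * \<gamma> * Delta_value x i d"
    if "0 \<le> t" "t \<le> 1" for t
    using F_eq_value[OF F_value_block_descent(1)[OF x d that]] F_eq_value[OF x] Delta_eq_value[OF x d]
    by (simp add: ok_def)
  have pow: "0 < \<beta> ^ j" "\<beta> ^ j \<le> 1" for j using \<beta> by (simp_all add: power_le_one)
  have small: "ok t" if t: "0 \<le> t" "t \<le> 1" "t \<le> a" for t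
  proof -
    have "L i * t \<le> 2 * (1 - \<gamma>) * \<kappa>"
      using t(3) L_pos[of i] by (simp add: a_def pos_le_divide_eq mult.commute)
    then have "(L i * t) * (norm d)\<^sup>2 \<le> (2 * (1 - \<gamma>) * \<kappa>) * (norm d)\<^sup>2"
      by (intro mult_right_mono) auto
    also have "\<dots> = 2 * (1 - \<gamma>) * (\<kappa> * (norm d)\<^sup>2)" by simp
    also have "\<dots> \<le> 2 * (1 - \<gamma>) * (- Delta_value x i d)"
      using \<kappa> \<gamma> by (intro mult_left_mono) auto
    finally have "t * ((L i * t) * (norm d)\<^sup>2) \<le> t * (2 * (1 - \<gamma>) * (- Delta_value x i d))"
      using t by (intro mult_left_mono) auto
    then have "t * Delta_value x i d + L i * t\<^sup>2 / 2 * (norm d)\<^sup>2 \<le> t * \<gamma> * Delta_value x i d"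
      by (simp add: algebra_simps power2_eq_square)
    then show ?thesis using F_value_block_descent(2)[OF x d t(1,2)] ok_iff[OF t(1,2)] by linarith
  qed
  obtain j0 where "\<beta> ^ j0 < a" using real_arch_pow_inv[OF a \<beta>(2)] by blast
  then have ex: "ok (\<beta> ^ j0)" using pow[of j0] by (intro small) auto
  define j where "j = (LEAST j. ok (\<beta> ^ j))"
  have j: "ok (\<beta> ^ j)" unfolding j_def using ex by (rule LeastI)
  have least: "j \<le> k" if "ok (\<beta> ^ k)" for k unfolding j_def using that by (rule Least_le)
  have \<alpha>: "\<alpha> = \<beta> ^ j"
    unfolding \<alpha>_def step_size_def ok_def[symmetric]
    using j least \<beta> by (intro Greatest_equality) (auto intro: power_decreasing)
  show "0 < \<alpha>" "\<alpha> \<le> 1" using pow \<alpha> by auto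
  then show "F (x + \<alpha> *\<^sub>R d) < \<infinity>" "F_value (x + \<alpha> *\<^sub>R d) \<le> F_value x + \<alpha> * \<gamma> * Delta_value x i d"
    using F_value_block_descent(1)[OF x d, of \<alpha>] ok_iff[of \<alpha>] j \<alpha> by auto
  show "min 1 (2 * \<beta> * (1 - \<gamma>) * \<kappa> / L i) \<le> \<alpha>"
  proof (cases j)
    case 0 then show ?thesis using \<alpha> by simp
  next
    case (Suc k)
    then have "\<not> ok (\<beta> ^ k)" using least[of k] by auto
    then have "a \<le> \<beta> ^ k" using small[of "\<beta> ^ k"] pow[of k] by fastforce
    then have "\<beta> * a \<le> \<alpha>" using \<beta> \<alpha> Suc by simp
    then show ?thesis by (simp add: a_def mult_ac min.coboundedI2)
  qed
qed

text \<open>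
  The blockwise first-order changes add up to the first-order change of \<open>F\<close> along \<open>y - x\<close>, which is
  at most \<open>F y - F x\<close> by convexity of \<open>f\<close>.
\<close>

lemma sum_Delta_value_le_gap:
  assumes "F x < \<infinity>" "F y < \<infinity>"
  shows "(\<Sum>i\<in>UNIV. Delta_value x i (blockpart i (y - x))) \<le> F_value y - F_value x"
proof -
  have "(\<Sum>i\<in>UNIV. Delta_value x i (blockpart i (y - x)))
      = gradf x \<bullet> (y - x) + (\<Sum>i\<in>UNIV. psi_value i (blockpart i y)) - (\<Sum>i\<in>UNIV. psi_value i (blockpart i x))"
    unfolding inner_sum_blocks[of blk "gradf x" "y - x", symmetric] Delta_value_def
    by (simp add: block_part_diff[of blk _ y x] sum.distrib sum_subtractf)
  then show ?thesis
    using convex_on_above_tangent[OF f_convex gradient, of x y] by (simp add: F_value_def)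
qed

end

section \<open>Expected decrease in one iteration\<close>

text \<open>
  One iteration with the past held fixed: \<open>d i\<close> is the direction used if block \<open>i\<close> is sampled.
\<close>

locale inexact_step = composite_problem blk f gradf \<psi> L
  for blk :: "'n::finite \<Rightarrow> 'b::finite" and f gradf \<psi> L +
  fixes m :: "'b \<Rightarrow> real" and \<beta> \<gamma> \<eta> c :: real
    and x :: "real^'n" and A :: "'b \<Rightarrow> real^'n^'n" and d :: "'b \<Rightarrow> real^'n"
  assumes m_pos: "\<And>i. m i > 0"
    and A_lower: "\<And>i v. v \<in> block_space blk i \<Longrightarrow> m i * (norm v)\<^sup>2 \<le> v \<bullet> (A i *v v)"
    and c: "\<And>y. ereal c \<le> objective blk f \<psi> y"
    and x: "objective blk f \<psi> x < \<infinity>"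
    and \<beta>: "0 < \<beta>" "\<beta> < 1" and \<gamma>: "0 < \<gamma>" "\<gamma> < 1" and \<eta>: "0 \<le> \<eta>" "\<eta> < 1"
    and d_approx: "\<And>i. approx_minimizer \<eta> (block_space blk i) (model blk gradf \<psi> (A i) x i) (d i)"
begin

abbreviation "\<alpha> i \<equiv> step_size blk f gradf \<psi> \<beta> \<gamma> x i (d i)"

lemma d_inexact_minimizer:
  shows "d i \<in> blockspace i" "\<psi> i (blockpart i x + d i) < \<infinity>"
    and "e \<in> blockspace i \<Longrightarrow> \<psi> i (blockpart i x + e) < \<infinity> \<Longrightarrow>
           model_value x i (A i) (d i) \<le> (1 - \<eta>) * model_value x i (A i) e"
  by (rule approx_minimizer_contraction[OF x m_pos A_lower c \<eta> d_approx]; assumption)+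

lemma zero_in_blockspace: "0 \<in> blockspace i" by (rule subspace_0[OF subspace_block_space])

lemma A_nonneg:
  assumes "v \<in> blockspace i" shows "0 \<le> v \<bullet> (A i *v v)"
proof -
  have "0 \<le> m i * (norm v)\<^sup>2" using m_pos[of i] by simp
  then show ?thesis using A_lower[OF assms] by linarith
qed

lemma model_value_d_nonpos: "model_value x i (A i) (d i) \<le> 0"
  using d_inexact_minimizer(3)[OF zero_in_blockspace, of i] psi_blockpart_finite[OF x, of i]
  by (simp add: model_value_def Delta_value_zero)

lemma Delta_value_d_le: "Delta_value x i (d i) \<le> - (d i \<bullet> (A i *v d i)) / (1 + sqrt \<eta>)"
proof (rule inexact_decrease_rate[OF \<eta> A_nonneg[OF d_inexact_minimizer(1)]])
  fix t :: real assume t: "0 \<le> t" "t \<le> 1"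
  have "model_value x i (A i) (d i) \<le> (1 - \<eta>) * model_value x i (A i) (t *\<^sub>R d i)"
    using Delta_value_scale(1)[OF x d_inexact_minimizer(1,2) t]
    by (intro d_inexact_minimizer(3) subspace_scale[OF subspace_block_space] d_inexact_minimizer(1))
  also have "\<dots> \<le> (1 - \<eta>) * (t * Delta_value x i (d i) + t\<^sup>2 * (d i \<bullet> (A i *v d i)) / 2)"
    using \<eta> by (intro mult_left_mono model_value_scale[OF x d_inexact_minimizer(1,2) t]) auto
  finally show "Delta_value x i (d i) + d i \<bullet> (A i *v d i) / 2
      \<le> (1 - \<eta>) * (t * Delta_value x i (d i) + t\<^sup>2 * (d i \<bullet> (A i *v d i)) / 2)"
    by (simp add: model_value_def)
qed

text \<open>
  This supplies the constant \<open>\<kappa>\<close> of \<open>backtracking_step\<close>, and with it the guaranteed step size.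
\<close>

lemma Delta_value_d_coercive: "m i / (1 + sqrt \<eta>) * (norm (d i))\<^sup>2 \<le> - Delta_value x i (d i)"
proof -
  have "m i * (norm (d i))\<^sup>2 / (1 + sqrt \<eta>) \<le> d i \<bullet> (A i *v d i) / (1 + sqrt \<eta>)"
    using \<eta> by (intro divide_right_mono A_lower d_inexact_minimizer(1)) auto
  then show ?thesis using Delta_value_d_le[of i] by simp
qed

lemma step_size_sufficient:
  shows "0 < \<alpha> i" "\<alpha> i \<le> 1"
    and "min 1 (2 * \<beta> * (1 - \<gamma>) * m i / (L i * (1 + sqrt \<eta>))) \<le> \<alpha> i"
    and "F (x + \<alpha> i *\<^sub>R d i) < \<infinity>"
    and "F_value (x + \<alpha> i *\<^sub>R d i) \<le> F_value x + \<alpha> i * \<gamma> * Delta_value x i (d i)"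
proof -
  have "0 < m i / (1 + sqrt \<eta>)" using m_pos[of i] \<eta> by (simp add: add_pos_nonneg)
  note s = backtracking_step[OF x d_inexact_minimizer(1,2) \<beta> \<gamma> this Delta_value_d_coercive]
  show "0 < \<alpha> i" "\<alpha> i \<le> 1" "F (x + \<alpha> i *\<^sub>R d i) < \<infinity>"
    "F_value (x + \<alpha> i *\<^sub>R d i) \<le> F_value x + \<alpha> i * \<gamma> * Delta_value x i (d i)"
    by (rule s(1) s(2) s(4) s(5))+
  show "min 1 (2 * \<beta> * (1 - \<gamma>) * m i / (L i * (1 + sqrt \<eta>))) \<le> \<alpha> i"
    using s(3) by (simp add: mult.commute)
qed

lemma step_monotone: "F_value (x + \<alpha> i *\<^sub>R d i) \<le> F_value x"
proof -
  have "Delta_value x i (d i) \<le> 0"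
    using model_value_d_nonpos[of i] A_nonneg[OF d_inexact_minimizer(1), of i] by (simp add: model_value_def)
  then have "\<alpha> i * \<gamma> * Delta_value x i (d i) \<le> 0"
    using step_size_sufficient(1)[of i] \<gamma> by (intro mult_nonneg_nonpos) auto
  then show ?thesis using step_size_sufficient(5)[of i] by linarith
qed

text \<open>
  The competitor for block \<open>i\<close> is \<open>t u\<^sub>i\<close> with \<open>u\<^sub>i\<close> the block of \<open>y - x\<close> and \<open>t = \<theta> \<omega> / w\<^sub>i\<close>.  The
  factor \<open>\<omega> / w\<^sub>i\<close> is there so that the factor \<open>w\<^sub>i\<close> in front of the model turns into the common
  factor \<open>\<theta> \<omega>\<close>; otherwise the first-order terms of the blocks would have different weights and
  could not be summed to \<open>F y - F x\<close>.
\<close>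

lemma expected_decrease:
  assumes y: "F y < \<infinity>"
    and w: "\<And>i. 0 < w i" "\<And>i. w i \<le> pmf q i * \<alpha> i"
    and \<omega>: "0 \<le> \<omega>" "\<And>i. \<omega> \<le> w i" and \<theta>: "0 \<le> \<theta>" "\<theta> \<le> 1"
  shows "(\<Sum>i\<in>UNIV. pmf q i * F_value (x + \<alpha> i *\<^sub>R d i))
    \<le> F_value x - (1 - \<eta>) * \<gamma> * (\<theta> * \<omega> * (F_value x - F_value y)
         - (\<theta> * \<omega>)\<^sup>2 / 2 * (\<Sum>i\<in>UNIV. blockpart i (x - y) \<bullet> (A i *v blockpart i (x - y)) / w i))"
proof -
  define D where "D i = blockpart i (x - y) \<bullet> (A i *v blockpart i (x - y))" for i
  define u where "u i = blockpart i (y - x)" for i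
  have u: "u i \<in> blockspace i" "blockpart i x + u i = blockpart i y" for i
    unfolding u_def by (simp, simp add: block_part_diff)
  have "u i = (- 1) *\<^sub>R blockpart i (x - y)" for i by (simp add: u_def block_part_diff)
  then have uD: "u i \<bullet> (A i *v u i) = D i" for i
    by (simp only: D_def matrix_vector_mult_scaleR) simp
  have block: "pmf q i * F_value (x + \<alpha> i *\<^sub>R d i)
      \<le> pmf q i * F_value x + \<gamma> * (1 - \<eta>) * (\<theta> * \<omega> * Delta_value x i (u i) + (\<theta> * \<omega>)\<^sup>2 / 2 * (D i / w i))" for i
  proof -
    define t where "t = \<theta> * \<omega> / w i"
    have "\<theta> * \<omega> \<le> 1 * w i" using \<theta> \<omega> by (intro mult_mono) auto
    then have t: "0 \<le> t" "t \<le> 1" using w(1)[of i] \<theta> \<omega> by (auto simp: t_def)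
    have wt: "w i * t = \<theta> * \<omega>" using w(1)[of i] by (simp add: t_def)
    have fin: "\<psi> i (blockpart i x + u i) < \<infinity>" using psi_blockpart_finite[OF y, of i] u by simp
    have "model_value x i (A i) (d i) \<le> (1 - \<eta>) * model_value x i (A i) (t *\<^sub>R u i)"
      by (intro d_inexact_minimizer(3) subspace_scale[OF subspace_block_space] u
          Delta_value_scale(1)[OF x _ fin] t)
    also have "\<dots> \<le> (1 - \<eta>) * (t * Delta_value x i (u i) + t\<^sup>2 * D i / 2)"
      using \<eta> model_value_scale[OF x u(1) fin t, of "A i"] uD[of i] by (intro mult_left_mono) auto
    finally have "w i * model_value x i (A i) (d i)
        \<le> w i * ((1 - \<eta>) * (t * Delta_value x i (u i) + t\<^sup>2 * D i / 2))"
      using w(1)[of i] by (intro mult_left_mono) auto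
    also have "\<dots> = (1 - \<eta>) * ((w i * t) * Delta_value x i (u i) + (w i * t) * t * D i / 2)"
      by (simp add: algebra_simps power2_eq_square)
    also have "\<dots> = (1 - \<eta>) * (\<theta> * \<omega> * Delta_value x i (u i) + (\<theta> * \<omega>)\<^sup>2 / 2 * (D i / w i))"
      unfolding wt by (simp add: t_def power2_eq_square)
    finally have model: "w i * model_value x i (A i) (d i)
        \<le> (1 - \<eta>) * (\<theta> * \<omega> * Delta_value x i (u i) + (\<theta> * \<omega>)\<^sup>2 / 2 * (D i / w i))" .
    \<comment> \<open>The model value at \<open>d i\<close> is nonpositive, so its weight may be lowered to \<open>w i\<close>.\<close>
    have "Delta_value x i (d i) \<le> model_value x i (A i) (d i)"
      using A_nonneg[OF d_inexact_minimizer(1), of i] by (simp add: model_value_def)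
    then have "pmf q i * \<alpha> i * Delta_value x i (d i) \<le> pmf q i * \<alpha> i * model_value x i (A i) (d i)"
      using step_size_sufficient(1)[of i] by (intro mult_left_mono) auto
    also have "\<dots> \<le> w i * model_value x i (A i) (d i)"
      by (intro mult_right_mono_neg w model_value_d_nonpos)
    also note model
    finally have "\<gamma> * (pmf q i * \<alpha> i * Delta_value x i (d i))
        \<le> \<gamma> * ((1 - \<eta>) * (\<theta> * \<omega> * Delta_value x i (u i) + (\<theta> * \<omega>)\<^sup>2 / 2 * (D i / w i)))"
      using \<gamma> by (intro mult_left_mono) auto
    moreover have "pmf q i * F_value (x + \<alpha> i *\<^sub>R d i) \<le> pmf q i * (F_value x + \<alpha> i * \<gamma> * Delta_value x i (d i))"
      by (intro mult_left_mono step_size_sufficient) simp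
    moreover have "pmf q i * (F_value x + \<alpha> i * \<gamma> * Delta_value x i (d i))
        = pmf q i * F_value x + \<gamma> * (pmf q i * \<alpha> i * Delta_value x i (d i))" by (simp add: distrib_left)
    ultimately show ?thesis by (simp only: mult.assoc)
  qed
  have "(\<Sum>i\<in>UNIV. pmf q i * F_value (x + \<alpha> i *\<^sub>R d i)) \<le> (\<Sum>i\<in>UNIV. pmf q i * F_value x
      + \<gamma> * (1 - \<eta>) * (\<theta> * \<omega> * Delta_value x i (u i) + (\<theta> * \<omega>)\<^sup>2 / 2 * (D i / w i)))"
    by (intro sum_mono block)
  also have "\<dots> = (\<Sum>i\<in>UNIV. pmf q i) * F_value x + \<gamma> * (1 - \<eta>) *
      (\<theta> * \<omega> * (\<Sum>i\<in>UNIV. Delta_value x i (u i)) + (\<theta> * \<omega>)\<^sup>2 / 2 * (\<Sum>i\<in>UNIV. D i / w i))"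
    by (simp only: sum.distrib sum_distrib_left sum_distrib_right distrib_left)
  also have "(\<Sum>i\<in>UNIV. pmf q i) = 1" by (rule sum_pmf_eq_1) auto
  also have "1 * F_value x + \<gamma> * (1 - \<eta>) *
      (\<theta> * \<omega> * (\<Sum>i\<in>UNIV. Delta_value x i (u i)) + (\<theta> * \<omega>)\<^sup>2 / 2 * (\<Sum>i\<in>UNIV. D i / w i))
    \<le> 1 * F_value x + \<gamma> * (1 - \<eta>) *
      (\<theta> * \<omega> * (F_value y - F_value x) + (\<theta> * \<omega>)\<^sup>2 / 2 * (\<Sum>i\<in>UNIV. D i / w i))"
    using sum_Delta_value_le_gap[OF x y] \<gamma> \<eta> \<theta> \<omega>(1) unfolding u_def
    by (intro add_left_mono mult_left_mono add_right_mono) auto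
  finally show ?thesis unfolding D_def by (simp add: algebra_simps)
qed

end

section \<open>The scalar recursion\<close>

text \<open>
  The choice \<open>\<theta> = x / (K \<pi>)\<close> maximizes the guaranteed decrease; it is at most \<open>1\<close> as \<open>x \<le> K \<pi>\<close>.
\<close>

lemma recursion_sublinear_step:
  fixes x y K c \<pi> :: real
  assumes step: "\<And>\<theta>. 0 \<le> \<theta> \<Longrightarrow> \<theta> \<le> 1 \<Longrightarrow> y \<le> x - c * (\<theta> * \<pi> * x - (\<theta> * \<pi>)\<^sup>2 * K / 2)"
    and K: "K > 0" and x: "0 \<le> x" "x \<le> K * \<pi>"
  shows "y \<le> x - c * x\<^sup>2 / (2 * K)"
proof (cases "\<pi> > 0")
  case True
  have "y \<le> x - c * (x / (K * \<pi>) * \<pi> * x - (x / (K * \<pi>) * \<pi>)\<^sup>2 * K / 2)"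
    by (rule step) (use x K True in \<open>auto simp: field_simps\<close>)
  also have "x / (K * \<pi>) * \<pi> = x / K" using True by simp
  also have "x - c * (x / K * x - (x / K)\<^sup>2 * K / 2) = x - c * x\<^sup>2 / (2 * K)"
    using K by (simp add: power2_eq_square)
  finally show ?thesis .
next
  case False
  then have "K * \<pi> \<le> 0" using K by (simp add: mult_nonneg_nonpos)
  then have "x = 0" using x by linarith
  then show ?thesis using step[of 0] by simp
qed

text \<open>
  Standard comparison with the sequence \<open>2 K / (2 N + c k)\<close>.  The start fits because
  \<open>\<pi> \<le> 1 / N\<close> bounds \<open>K \<pi>\<close> by \<open>K / N\<close>, which is where the number of blocks enters the bound.
\<close>

lemma recursion_sublinear:
  fixes \<delta> :: "nat \<Rightarrow> real"
  assumes step: "\<And>k \<theta>. 0 \<le> \<theta> \<Longrightarrow> \<theta> \<le> 1 \<Longrightarrow>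
        \<delta> (Suc k) \<le> \<delta> k - c * (\<theta> * \<pi> * \<delta> k - (\<theta> * \<pi>)\<^sup>2 * K / 2)"
    and nonneg: "\<And>k. 0 \<le> \<delta> k" and K: "0 \<le> K" and c: "0 < c" "c \<le> 1"
    and N: "1 \<le> N" "\<pi> \<le> 1 / N" and start: "\<delta> 0 \<le> K * \<pi>"
  shows "\<delta> k \<le> 2 * K / (2 * N + c * real k)"
proof -
  have decr: "\<delta> (Suc k) \<le> \<delta> k" for k using step[of 0] by simp
  have low: "\<delta> k \<le> K * \<pi>" for k
    by (induction k) (use start decr order_trans in blast)+
  show ?thesis
  proof (cases "K = 0")
    case True then show ?thesis using low by simp
  next
    case False
    then have K: "K > 0" using K by simp
    show ?thesis
    proof (induction k)
      case 0
      have "K * \<pi> \<le> K * (1 / N)" using K N by (intro mult_left_mono) auto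
      then show ?case using start by simp
    next
      case (Suc k)
      define s where "s = 2 * N + c * real k"
      have s: "s \<ge> 2" using N c unfolding s_def by (simp add: add_increasing2)
      let ?u = "2 * K / s"
      have u: "\<delta> k \<le> ?u" using Suc.IH s_def by simp
      have uK: "?u \<le> K" using s K by (simp add: field_simps)
      \<comment> \<open>the map \<open>x \<mapsto> x - c x\<^sup>2 / (2 K)\<close> is increasing on \<open>[0, K]\<close> because \<open>c \<le> 1\<close>\<close>
      have "c * (\<delta> k + ?u) \<le> 1 * (K + K)"
        using c uK u nonneg[of k] by (intro mult_mono) auto
      then have "(?u - \<delta> k) * (c * (\<delta> k + ?u)) \<le> (?u - \<delta> k) * (2 * K)"
        using u by (intro mult_left_mono) auto
      then have "(?u - \<delta> k) * (c * (\<delta> k + ?u)) / (2 * K) \<le> ?u - \<delta> k"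
        using K by (simp add: pos_divide_le_eq)
      then have mono: "\<delta> k - c * (\<delta> k)\<^sup>2 / (2 * K) \<le> ?u - c * ?u\<^sup>2 / (2 * K)"
        by (simp add: algebra_simps power2_eq_square diff_divide_distrib add_divide_distrib)
      have "?u - c * ?u\<^sup>2 / (2 * K) = 2 * K * ((s - c) / s\<^sup>2)"
        using K s by (simp add: field_simps power2_eq_square)
      also have "(s - c) / s\<^sup>2 \<le> 1 / (s + c)"
        using s c by (simp add: field_simps power2_eq_square)
      finally have "?u - c * ?u\<^sup>2 / (2 * K) \<le> 2 * K / (s + c)" using K by simp
      then show ?case
        using recursion_sublinear_step[OF step K nonneg low, of k] mono
        by (simp add: s_def algebra_simps)
    qed
  qed
qed

text \<open>
  While \<open>\<delta>\<close> is above \<open>K \<pi>\<close>, the choice \<open>\<theta> = 1\<close> gives a contraction; and once it is below, it stays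
  there, since \<open>\<theta> = 0\<close> shows that \<open>\<delta>\<close> never increases.
\<close>

lemma recursion_linear_phase:
  fixes \<delta> :: "nat \<Rightarrow> real"
  assumes step: "\<And>k \<theta>. 0 \<le> \<theta> \<Longrightarrow> \<theta> \<le> 1 \<Longrightarrow>
        \<delta> (Suc k) \<le> \<delta> k - c * (\<theta> * \<pi> * \<delta> k - (\<theta> * \<pi>)\<^sup>2 * K / 2)"
    and c: "0 \<le> c" "c \<le> 1" and \<pi>: "0 \<le> \<pi>" "\<pi> \<le> 1"
  shows "\<delta> k \<le> max (K * \<pi>) ((1 - c * \<pi> / 2) ^ k * \<delta> 0)"
proof (induction k)
  case (Suc k)
  show ?case
  proof (cases "\<delta> k \<le> K * \<pi>")
    case True
    then show ?thesis using step[of 0 k] by simp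
  next
    case False
    have "c * (\<pi> * (K * \<pi>)) \<le> c * (\<pi> * \<delta> k)"
      using False c \<pi> by (intro mult_left_mono) auto
    then have "\<delta> (Suc k) \<le> (1 - c * \<pi> / 2) * \<delta> k"
      using step[of 1 k] by (simp add: algebra_simps power2_eq_square)
    also have "\<dots> \<le> (1 - c * \<pi> / 2) * ((1 - c * \<pi> / 2) ^ k * \<delta> 0)"
      using Suc False c \<pi> mult_le_one[of c \<pi>] by (intro mult_left_mono) auto
    finally show ?thesis by simp
  qed
qed simp

lemma power_threshold:
  fixes r D T :: real
  assumes "0 < r" "r < 1" "0 < D" "0 < T"
  shows "r ^ k * D \<le> T \<longleftrightarrow> ln (D / T) / ln (1 / r) \<le> real k"
proof -
  have "r ^ k * D \<le> T \<longleftrightarrow> ln (r ^ k * D) \<le> ln T" using assms by simp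
  also have "\<dots> \<longleftrightarrow> ln (D / T) \<le> real k * ln (1 / r)"
    using assms by (simp add: ln_mult ln_realpow ln_div) linarith
  also have "\<dots> \<longleftrightarrow> ln (D / T) / ln (1 / r) \<le> real k"
    using assms by (intro pos_divide_le_eq[symmetric]) simp
  finally show ?thesis .
qed

text \<open>
  The index \<open>k0\<close> is the first \<open>k\<close> at which the geometric bound \<open>(1 - c \<pi> / 2)\<^sup>k \<delta> 0\<close> has come
  down to \<open>K \<pi>\<close>.  Before \<open>k0\<close> the geometric bound is the larger of the two terms in
  \<open>recursion_linear_phase\<close>, even if \<open>\<delta>\<close> itself has already dropped below \<open>K \<pi>\<close>.
\<close>

lemma recursion_two_phases:
  fixes \<delta> :: "nat \<Rightarrow> real"
  assumes step: "\<And>k \<theta>. 0 \<le> \<theta> \<Longrightarrow> \<theta> \<le> 1 \<Longrightarrow>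
        \<delta> (Suc k) \<le> \<delta> k - c * (\<theta> * \<pi> * \<delta> k - (\<theta> * \<pi>)\<^sup>2 * K / 2)"
    and nonneg: "\<And>k. 0 \<le> \<delta> k" and K: "0 \<le> K" "\<delta> 0 \<noteq> 0 \<Longrightarrow> 0 < K" and c: "0 < c" "c \<le> 1"
    and N: "1 \<le> N" and \<pi>: "0 < \<pi>" "\<pi> \<le> 1 / N"
    and k0: "k0 = (if \<delta> 0 = 0 then 0
                   else nat \<lceil>max 0 (ln (\<delta> 0 / (K * \<pi>)) / ln (2 / (2 - c * \<pi>)))\<rceil>)"
  shows "k < k0 \<Longrightarrow> \<delta> k \<le> (1 - c * \<pi> / 2) ^ k * \<delta> 0"
    and "k0 \<le> k \<Longrightarrow> \<delta> k \<le> 2 * K / (2 * N + c * (real k - real k0))"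
proof -
  define r where "r = 1 - c * \<pi> / 2"
  define ratio where "ratio = ln (\<delta> 0 / (K * \<pi>)) / ln (1 / r)"
  have "1 / N \<le> 1" using N by simp
  then have \<pi>1: "\<pi> \<le> 1" using \<pi> by linarith
  have c\<pi>: "0 < c * \<pi>" "c * \<pi> \<le> 1" using c \<pi> \<pi>1 by (auto intro: mult_le_one)
  then have r: "0 < r" "r < 1" by (auto simp: r_def)
  have "1 / r = 2 / (2 - c * \<pi>)" using r by (simp add: r_def field_simps)
  then have k0: "k0 = (if \<delta> 0 = 0 then 0 else nat \<lceil>max 0 ratio\<rceil>)" by (simp add: k0 ratio_def)
  have phase: "\<delta> k \<le> max (K * \<pi>) (r ^ k * \<delta> 0)" for k
    unfolding r_def by (rule recursion_linear_phase) (use step c \<pi> \<pi>1 in auto)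
  have threshold: "r ^ k * \<delta> 0 \<le> K * \<pi> \<longleftrightarrow> ratio \<le> real k" if "\<delta> 0 \<noteq> 0" for k
    unfolding ratio_def using r K(2)[OF that] nonneg[of 0] that \<pi> by (intro power_threshold) auto
  {
    assume "k < k0"
    then have "\<delta> 0 \<noteq> 0" "real k < ratio"
      by (auto simp: k0 zless_nat_eq_int_zless less_ceiling_iff split: if_splits)
    then have "\<not> r ^ k * \<delta> 0 \<le> K * \<pi>" using threshold by simp
    then show "\<delta> k \<le> (1 - c * \<pi> / 2) ^ k * \<delta> 0" using phase[of k] by (simp add: r_def)
  }
  have start: "\<delta> k0 \<le> K * \<pi>"
  proof (cases "\<delta> 0 = 0")
    case True
    then show ?thesis using K \<pi> by (simp add: k0)
  next
    case False
    then have "ratio \<le> real k0" by (simp add: k0) linarith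
    then have "r ^ k0 * \<delta> 0 \<le> K * \<pi>" using threshold False by simp
    then show ?thesis using phase[of k0] by simp
  qed
  assume "k0 \<le> k"
  have late: "\<delta> (k0 + n) \<le> 2 * K / (2 * N + c * real n)" for n
    by (rule recursion_sublinear[where \<delta> = "\<lambda>n. \<delta> (k0 + n)" and \<pi> = \<pi>])
       (use step nonneg K c N \<pi> start in auto)
  show "\<delta> k \<le> 2 * K / (2 * N + c * (real k - real k0))"
    using late[of "k - k0"] \<open>k0 \<le> k\<close> by (simp add: of_nat_diff)
qed

section \<open>Expectations along a run\<close>

lemma finite_set_run_pmf: "finite (set_pmf (run_pmf p n h))"
  for p :: "'b::finite list \<Rightarrow> 'b pmf"
  by (induction n) auto

lemma set_run_pmf_extends: "h' \<in> set_pmf (run_pmf p n h) \<Longrightarrow> \<exists>l. h' = l @ h"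
  by (induction n arbitrary: h') (auto, metis append_Cons)

lemma expectation_finite_sum:
  fixes g :: "'b::finite \<Rightarrow> real"
  shows "measure_pmf.expectation q g = (\<Sum>i\<in>UNIV. pmf q i * g i)"
  by (subst integral_measure_pmf[of UNIV]) auto

lemma expectation_run_pmf:
  fixes g :: "'b::finite list \<Rightarrow> real"
  shows "measure_pmf.expectation (run_pmf p n h) g
           = (\<Sum>h'\<in>set_pmf (run_pmf p n h). pmf (run_pmf p n h) h' * g h')"
  by (subst integral_measure_pmf[OF finite_set_run_pmf]) auto

lemma expectation_run_pmf_Suc:
  fixes g :: "'b::finite list \<Rightarrow> real"
  shows "measure_pmf.expectation (run_pmf p (Suc n) h) g
    = measure_pmf.expectation (run_pmf p n h) (\<lambda>h'. measure_pmf.expectation (p h') (\<lambda>i. g (i # h')))"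
  by (simp add: expectation_run_pmf[of p n])
     (subst pmf_expectation_bind[OF finite_set_run_pmf], auto)

lemma integrable_run_pmf: "integrable (measure_pmf (run_pmf p n h)) (g :: 'b::finite list \<Rightarrow> real)"
  by (rule integrable_measure_pmf_finite[OF finite_set_run_pmf])

text \<open>
  Linearity and monotonicity of the expectation.  This is why a one-step bound with coefficients
  that do not depend on the history is sought.
\<close>

lemma expectation_run_pmf_step:
  fixes g :: "'b::finite list \<Rightarrow> real"
  assumes "\<And>l. measure_pmf.expectation (p (l @ h)) (\<lambda>i. g (i # l @ h)) \<le> a * g (l @ h) + b"
  shows "measure_pmf.expectation (run_pmf p (Suc n) h) g
           \<le> a * measure_pmf.expectation (run_pmf p n h) g + b"
proof -
  have "measure_pmf.expectation (run_pmf p (Suc n) h) g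
      \<le> measure_pmf.expectation (run_pmf p n h) (\<lambda>h'. a * g h' + b)"
    unfolding expectation_run_pmf_Suc
    using assms by (intro integral_mono_AE integrable_run_pmf)
      (auto simp: AE_measure_pmf_iff dest!: set_run_pmf_extends)
  also have "\<dots> = a * measure_pmf.expectation (run_pmf p n h) g + b"
    by (simp add: integrable_run_pmf)
  finally show ?thesis .
qed

section \<open>The convergence rates\<close>

theorem theorem1:
  fixes blk :: "'n::finite \<Rightarrow> 'b::finite"
    and f :: "real^'n \<Rightarrow> real"
    and gradf :: "real^'n \<Rightarrow> real^'n"
    and \<psi> :: "'b \<Rightarrow> real^'n \<Rightarrow> ereal"
    and L m :: "'b \<Rightarrow> real"
    and \<beta> \<gamma> \<eta> R0 Fmin :: real
    and x0 :: "real^'n"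
    and p :: "'b list \<Rightarrow> 'b pmf"
    and H :: "'b list \<Rightarrow> 'b \<Rightarrow> real^'n^'n"
    and d :: "'b list \<Rightarrow> 'b \<Rightarrow> real^'n"
    and F :: "real^'n \<Rightarrow> ereal"
    and \<Omega> :: "(real^'n) set"
    and proj :: "real^'n \<Rightarrow> real^'n"
    and X :: "'b list \<Rightarrow> real^'n"
    and \<alpha> :: "'b list \<Rightarrow> 'b \<Rightarrow> real"
    and gap :: "'b list \<Rightarrow> real"
    and abar :: "'b \<Rightarrow> real"
    and pibar :: "'b pmf \<Rightarrow> real"
    and C :: "'b pmf \<Rightarrow> ('b \<Rightarrow> real) \<Rightarrow> real"
  assumes F_def: "F = objective blk f \<psi>"
    and Fmin_def: "Fmin = real_of_ereal (INF x. F x)"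
    and Omega_def: "\<Omega> = minimizers F"
    and proj_def: "proj = closest_point \<Omega>"
    and R0_def: "R0 = (SUP x\<in>{x. F x \<le> F x0}. norm (x - proj x))"
    and X_def: "X = iterate blk f gradf \<psi> \<beta> \<gamma> d x0"
    and alpha_def: "\<And>h i. \<alpha> h i = step_size blk f gradf \<psi> \<beta> \<gamma> (X h) i (d h i)"
    and gap_def: "\<And>h. gap h = real_of_ereal (F (X h)) - Fmin"
    and abar_def: "\<And>i. abar i = min 1 (2 * \<beta> * (1 - \<gamma>) * m i / (L i * (1 + sqrt \<eta>)))"
    and pibar_def: "\<And>q. pibar q = (MIN i. abar i * pmf q i)"
    and C_def: "\<And>q M. C q M = spectral_norm
           (matrix_inv (block_diag blk (\<lambda>i. pmf q i *\<^sub>R block_id blk i))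
            ** matrix_inv (block_diag blk (\<lambda>i. abar i *\<^sub>R block_id blk i))
            ** block_diag blk (\<lambda>i. M i *\<^sub>R block_id blk i))"
    and blocks: "surj blk"
    and gradient: "\<And>x. GDERIV f x :> gradf x" "continuous_on UNIV gradf"
    and L_pos: "\<And>i. L i > 0"
    and block_lipschitz: "\<And>i x v. v \<in> block_space blk i \<Longrightarrow>
          norm (block_part blk i (gradf (x + v)) - block_part blk i (gradf x)) \<le> L i * norm v"
    and f_convex: "convex_on UNIV f"
    and psi: "\<And>i. proper_closed_convex (block_space blk i) (\<psi> i)"
    and F_bounded_below: "\<exists>c::real. \<forall>x. ereal c \<le> F x"
    and minimizers_nonempty: "\<Omega> \<noteq> {}"
    and beta: "0 < \<beta>" "\<beta> < 1"
    and gamma: "0 < \<gamma>" "\<gamma> < 1"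
    and eta: "0 \<le> \<eta>" "\<eta> < 1"
    and x0: "F x0 < \<infinity>"
    and R0_finite: "bdd_above ((\<lambda>x. norm (x - proj x)) ` {x. F x \<le> F x0})"
    and p_pos: "\<And>h i. pmf (p h) i > 0"
    and H_spd: "\<And>h i. block_spd blk i (H h i)"
    and m_pos: "\<And>i. m i > 0"
    and H_lower: "\<And>h i. H h i \<succeq> m i *\<^sub>R block_id blk i"
    and d_approx: "\<And>h i. approx_minimizer \<eta> (block_space blk i)
                     (model blk gradf \<psi> (H h i) (X h) i) (d h i)"
  shows
    \<comment> \<open>All objective values met by the algorithm are finite, so that \<^term>\<open>gap\<close> is meaningful.\<close>
    "(\<forall>h. \<bar>F (X h)\<bar> \<noteq> \<infinity>) \<and>
     (\<forall>h. let \<pi> = (MIN i. \<alpha> h i * pmf (p h) i);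
              P = block_diag blk (\<lambda>i. pmf (p h) i *\<^sub>R block_id blk i);
              A = block_diag blk (\<lambda>i. \<alpha> h i *\<^sub>R block_id blk i);
              Hk = block_diag blk (H h);
              v = X h - proj (X h)
          in gap h > 0 \<longrightarrow>
             gap h \<ge> (v \<bullet> ((matrix_inv P ** matrix_inv A ** Hk) *v v)) * \<pi> \<longrightarrow>
             measure_pmf.expectation (p h) (\<lambda>i. gap (i # h)) / gap h
               \<le> 1 - (1 - \<eta>) * \<gamma> * \<pi> / 2) \<and>
     \<comment> \<open>Here \<open>h\<close> is a history up to \<open>k\<^sub>0\<close>, which is its length.\<close>
     (\<forall>M q h.
        (\<forall>i. M i \<ge> m i) \<longrightarrow> (\<forall>i. pmf q i > 0) \<longrightarrow>
        gap h < C q M * pibar q * R0\<^sup>2 \<longrightarrow>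
        (\<forall>h'. strict_suffix h' h \<longrightarrow> \<not> gap h' < C q M * pibar q * R0\<^sup>2) \<longrightarrow>
        (\<forall>l. p (l @ h) = q) \<longrightarrow>
        (\<forall>l i. M i *\<^sub>R block_id blk i \<succeq> H (l @ h) i) \<longrightarrow>
        (\<forall>k\<ge>length h.
           measure_pmf.expectation (run_pmf p (k - length h) h) (\<lambda>h'. real_of_ereal (F (X h'))) - Fmin
             \<le> 2 * C q M * R0\<^sup>2
                 / (2 * real CARD('b) + (1 - \<eta>) * \<gamma> * (real k - real (length h))))) \<and>
     (\<forall>M q.
        (\<forall>i. M i \<ge> m i) \<longrightarrow> (\<forall>i. pmf q i > 0) \<longrightarrow>
        (\<forall>h. p h = q) \<longrightarrow>
        (\<forall>h i. M i *\<^sub>R block_id blk i \<succeq> H h i) \<longrightarrow>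
        (let k0 = (if gap [] = 0 then 0
                   else nat \<lceil>max 0 (ln (gap [] / (C q M * pibar q * R0\<^sup>2))
                                  / ln (2 / (2 - (1 - \<eta>) * \<gamma> * pibar q)))\<rceil>)
         in (\<forall>k<k0. measure_pmf.expectation (run_pmf p k []) gap
                      \<le> (1 - (1 - \<eta>) * \<gamma> * pibar q / 2) ^ k * gap []) \<and>
            (\<forall>k\<ge>k0. measure_pmf.expectation (run_pmf p k []) gap
                      \<le> 2 * C q M * R0\<^sup>2
                          / (2 * real CARD('b) + (1 - \<eta>) * \<gamma> * (real k - real k0)))))"
proof -
  obtain c where c: "\<And>x. ereal c \<le> F x" using F_bounded_below by blast
  interpret P: composite_problem blk f gradf \<psi> L
    by unfold_locales (fact gradient L_pos block_lipschitz f_convex psi)+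
  note F_eq_value = P.F_eq_value[folded F_def]
  obtain z where z: "z \<in> \<Omega>" using minimizers_nonempty by blast
  then have z_min: "F z \<le> F y" for y unfolding Omega_def minimizers_def by blast
  then have z_fin: "F z < \<infinity>" using x0 le_less_trans by blast
  have "(INF x. F x) = F z"
    by (rule antisym[OF INF_lower INF_greatest]) (auto intro: z_min)
  then have Fmin: "F z = ereal Fmin" "Fmin = P.F_value z"
    using F_eq_value[OF z_fin] unfolding Fmin_def by simp_all
  have "closed \<Omega>"
    using P.closed_minimizers z z_fin unfolding Omega_def F_def by blast
  then have "proj y \<in> \<Omega>" for y
    unfolding proj_def using minimizers_nonempty by (rule closest_point_in_set)
  then have "F (proj y) = F z" for y
    unfolding Omega_def minimizers_def by (intro antisym z_min) blast
  then have proj: "F (proj y) < \<infinity>" "P.F_value (proj y) = Fmin" for y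
    using z_fin Fmin F_eq_value[of "proj y"] by simp_all
  have X_Cons: "X (i # h) = X h + \<alpha> h i *\<^sub>R d h i" for i h
    by (simp add: X_def alpha_def Let_def)
  have step: "inexact_step blk f gradf \<psi> L m \<beta> \<gamma> \<eta> c (X h) (H h) (d h)" if "F (X h) < \<infinity>" for h
  proof
    show "m i * (norm v)\<^sup>2 \<le> v \<bullet> (H h i *v v)" if "v \<in> block_space blk i" for i v
      using loewner_ge_quadratic[OF H_lower[of h i], of v] block_id_quadratic[OF that] by simp
  qed (use m_pos c that beta gamma eta d_approx in \<open>auto simp: F_def\<close>)
  \<comment> \<open>The facts about a step require \<open>F (X h)\<close> to be finite, which only the previous step provides.\<close>
  have X_fin: "F (X h) < \<infinity> \<and> P.F_value (X h) \<le> P.F_value x0" for h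
  proof (induction h)
    case Nil
    then show ?case using x0 by (simp add: X_def)
  next
    case (Cons i h)
    then interpret S: inexact_step blk f gradf \<psi> L m \<beta> \<gamma> \<eta> c "X h" "H h" "d h"
      using step by blast
    show ?case
      using S.step_size_sufficient(4)[of i] S.step_monotone[of i] Cons
      unfolding X_Cons alpha_def F_def by auto
  qed
  interpret S: inexact_step blk f gradf \<psi> L m \<beta> \<gamma> \<eta> c "X h" "H h" "d h" for h
    using step X_fin by blast
  have F_X: "F (X h) = ereal (P.F_value (X h))" for h
    using F_eq_value X_fin by blast
  have gap: "gap h = P.F_value (X h) - Fmin" for h by (simp add: gap_def F_X)
  have gap_nonneg: "gap h \<ge> 0" for h using z_min[of "X h"] by (simp add: gap F_X Fmin(1))
  have gap_decr: "gap (i # h) \<le> gap h" for i h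
    using S.step_monotone[where h = h and i = i] by (simp add: gap X_Cons alpha_def)
  have alpha_pos: "\<alpha> h i > 0" for h i
    using S.step_size_sufficient(1)[where h = h and i = i] by (simp add: alpha_def)
  have abar_le: "abar i \<le> \<alpha> h i" for h i
    using S.step_size_sufficient(3)[where h = h and i = i] by (simp add: alpha_def abar_def)
  have abar_pos: "abar i > 0" for i
    using beta gamma m_pos[of i] L_pos[of i] eta
    by (auto simp: abar_def intro!: divide_pos_pos mult_pos_pos add_pos_nonneg)
  have abar_le_1: "abar i \<le> 1" for i by (simp add: abar_def)

  have R0: "norm (X h - proj (X h)) \<le> R0" for h
    unfolding R0_def
  proof (rule cSUP_upper[OF _ R0_finite])
    have "F x0 = ereal (P.F_value x0)" using F_eq_value x0 by blast
    then show "X h \<in> {x. F x \<le> F x0}" using X_fin[of h] by (simp add: F_X)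
  qed
  have R0_nonneg: "R0 \<ge> 0" using R0[of "[]"] norm_ge_zero order_trans by blast

  have decrease: "measure_pmf.expectation (p h) (\<lambda>i. gap (i # h))
      \<le> gap h - (1 - \<eta>) * \<gamma> * (\<theta> * \<omega> * gap h - (\<theta> * \<omega>)\<^sup>2 / 2 *
          (\<Sum>i\<in>UNIV. block_part blk i (X h - proj (X h)) \<bullet>
             (H h i *v block_part blk i (X h - proj (X h))) / w i))"
    if "\<And>i. 0 < w i" "\<And>i. w i \<le> pmf (p h) i * \<alpha> h i" "0 \<le> \<omega>" "\<And>i. \<omega> \<le> w i"
      "0 \<le> \<theta>" "\<theta> \<le> 1" for h w \<omega> \<theta>
  proof -
    have "measure_pmf.expectation (p h) (\<lambda>i. gap (i # h))
        = (\<Sum>i\<in>UNIV. pmf (p h) i * P.F_value (X (i # h))) - (\<Sum>i\<in>UNIV. pmf (p h) i) * Fmin"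
      by (simp add: expectation_finite_sum gap right_diff_distrib sum_subtractf sum_distrib_right)
    also have "(\<Sum>i\<in>UNIV. pmf (p h) i) = 1" by (rule sum_pmf_eq_1) auto
    finally show ?thesis
      using S.expected_decrease[OF proj(1)[unfolded F_def] that(1) that(2)[unfolded alpha_def] that(3-),
          of "X h"]
      by (simp add: X_Cons alpha_def gap proj(2))
  qed

  \<comment> \<open>Weights \<open>p\<^sub>i \<alpha>\<^sub>i\<close> and \<open>\<theta> = 1\<close>: the hypothesis lets the second-order term
    cost at most half of the first-order decrease.\<close>
  have part1: "let \<pi> = (MIN i. \<alpha> h i * pmf (p h) i);
              P = block_diag blk (\<lambda>i. pmf (p h) i *\<^sub>R block_id blk i);
              A = block_diag blk (\<lambda>i. \<alpha> h i *\<^sub>R block_id blk i);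
              Hk = block_diag blk (H h);
              v = X h - proj (X h)
          in gap h > 0 \<longrightarrow>
             gap h \<ge> (v \<bullet> ((matrix_inv P ** matrix_inv A ** Hk) *v v)) * \<pi> \<longrightarrow>
             measure_pmf.expectation (p h) (\<lambda>i. gap (i # h)) / gap h
               \<le> 1 - (1 - \<eta>) * \<gamma> * \<pi> / 2" for h
    unfolding Let_def
  proof (intro impI)
    define \<pi> where "\<pi> = (MIN i. \<alpha> h i * pmf (p h) i)"
    define v where "v = X h - proj (X h)"
    define V where "V = v \<bullet> ((matrix_inv (block_diag blk (\<lambda>i. pmf (p h) i *\<^sub>R block_id blk i))
        ** matrix_inv (block_diag blk (\<lambda>i. \<alpha> h i *\<^sub>R block_id blk i)) ** block_diag blk (H h)) *v v)"
    assume pos: "gap h > 0" and "gap h \<ge> (X h - proj (X h)) \<bullet>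
        ((matrix_inv (block_diag blk (\<lambda>i. pmf (p h) i *\<^sub>R block_id blk i))
        ** matrix_inv (block_diag blk (\<lambda>i. \<alpha> h i *\<^sub>R block_id blk i)) ** block_diag blk (H h))
        *v (X h - proj (X h))) * (MIN i. \<alpha> h i * pmf (p h) i)"
    then have le: "V * \<pi> \<le> gap h" unfolding V_def v_def \<pi>_def by simp
    have Hb: "block_matrix blk i (H h i)" for i using H_spd[of i h] by (simp add: block_spd_def)
    have "V = v \<bullet> (block_diag blk (\<lambda>i. (1 / (pmf (p h) i * \<alpha> h i)) *\<^sub>R H h i) *v v)"
      unfolding V_def using p_pos[of h] alpha_pos[of h]
      by (subst inverse_scalings_mult_block_diag) (auto simp: less_le)
    also have "\<dots> = (\<Sum>i\<in>UNIV. block_part blk i v \<bullet> (H h i *v block_part blk i v)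
        / (pmf (p h) i * \<alpha> h i))"
      by (subst block_diag_quadratic)
         (use Hb in \<open>auto simp: block_matrix_def scaleR_matrix_vector_assoc[symmetric]\<close>)
    finally have V: "V = \<dots>" .
    have \<pi>_le: "\<pi> \<le> pmf (p h) i * \<alpha> h i" for i
      unfolding \<pi>_def by (subst mult.commute) (auto intro: Min_le)
    have "\<pi> \<in> range (\<lambda>i. \<alpha> h i * pmf (p h) i)" unfolding \<pi>_def by (rule Min_in) auto
    then have \<pi>_pos: "\<pi> > 0" using alpha_pos p_pos by auto
    have "measure_pmf.expectation (p h) (\<lambda>i. gap (i # h))
        \<le> gap h - (1 - \<eta>) * \<gamma> * (1 * \<pi> * gap h - (1 * \<pi>)\<^sup>2 / 2 * V)"
      unfolding V unfolding v_def
      by (rule decrease) (use \<pi>_le \<pi>_pos alpha_pos p_pos in auto)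
    also have "\<dots> \<le> gap h - (1 - \<eta>) * \<gamma> * (\<pi> * gap h / 2)"
    proof -
      have "\<pi> * (V * \<pi>) \<le> \<pi> * gap h" using le \<pi>_pos by (intro mult_left_mono) auto
      then have "\<pi> * gap h / 2 \<le> 1 * \<pi> * gap h - (1 * \<pi>)\<^sup>2 / 2 * V"
        by (simp add: power2_eq_square mult_ac)
      then show ?thesis using eta gamma by (intro diff_left_mono mult_left_mono) auto
    qed
    also have "\<dots> = (1 - (1 - \<eta>) * \<gamma> * \<pi> / 2) * gap h" by (simp add: algebra_simps)
    finally show "measure_pmf.expectation (p h) (\<lambda>i. gap (i # h)) / gap h
        \<le> 1 - (1 - \<eta>) * \<gamma> * (MIN i. \<alpha> h i * pmf (p h) i) / 2"
      using pos by (simp add: pos_divide_le_eq flip: \<pi>_def)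
  qed

  have C_ge: "M i / (pmf q i * abar i) \<le> C q M" if q: "\<And>i. pmf q i > 0" for q M i
  proof -
    have "block_diag blk (\<lambda>i. (1 / (pmf q i * abar i)) *\<^sub>R M i *\<^sub>R block_id blk i)
        = block_diag blk (\<lambda>i. (M i / (pmf q i * abar i)) *\<^sub>R block_id blk i)" by simp
    moreover have "pmf q i \<noteq> 0" "abar i \<noteq> 0" for i using q[of i] abar_pos[of i] by auto
    ultimately have "C q M = onorm ((*v) (block_diag blk (\<lambda>i. (M i / (pmf q i * abar i)) *\<^sub>R block_id blk i)))"
      unfolding C_def by (subst inverse_scalings_mult_block_diag) simp_all
    then show ?thesis using onorm_block_diag_scalar_ge[OF blocks] by metis
  qed

  have pibar_le: "pibar q \<le> abar i * pmf q i" for q i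
    unfolding pibar_def by (auto intro: Min_le)
  have pibar_pos: "pibar q > 0" if "\<And>i. pmf q i > 0" for q
  proof -
    have "pibar q \<in> range (\<lambda>i. abar i * pmf q i)" unfolding pibar_def by (rule Min_in) auto
    then show ?thesis using abar_pos that by auto
  qed
  \<comment> \<open>\<open>pibar q\<close> is at most each of the \<open>N\<close> probabilities \<open>pmf q i\<close>, which sum to one.\<close>
  have pibar_le_N: "pibar q \<le> 1 / real CARD('b)" for q :: "'b pmf"
  proof -
    have "pibar q \<le> pmf q i" for i
      using pibar_le[of q i] mult_right_mono[OF abar_le_1[of i], of "pmf q i"] by simp
    then have "(\<Sum>i\<in>(UNIV :: 'b set). pibar q) \<le> (\<Sum>i\<in>UNIV. pmf q i)" by (rule sum_mono)
    also have "\<dots> = 1" by (rule sum_pmf_eq_1) auto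
    finally show ?thesis by (simp add: field_simps)
  qed

  \<comment> \<open>The guaranteed step sizes give weights, and hence coefficients, that do not vary with the history.\<close>
  have fixed_decrease: "measure_pmf.expectation (p h) (\<lambda>i. gap (i # h))
      \<le> gap h - (1 - \<eta>) * \<gamma> * (\<theta> * pibar q * gap h - (\<theta> * pibar q)\<^sup>2 * (C q M * R0\<^sup>2) / 2)"
    if q: "\<And>i. pmf q i > 0" "p h = q" and M: "\<And>i. M i *\<^sub>R block_id blk i \<succeq> H h i"
      and \<theta>: "0 \<le> \<theta>" "\<theta> \<le> 1" for h q M \<theta>
  proof -
    define v where "v = X h - proj (X h)"
    define w where "w i = abar i * pmf q i" for i
    define V where "V = (\<Sum>i\<in>UNIV. block_part blk i v \<bullet> (H h i *v block_part blk i v) / w i)"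
    have w: "0 < w i" for i using abar_pos q(1) by (simp add: w_def)
    have C0: "0 \<le> C q M" unfolding C_def by (rule onorm_pos_le) simp
    have "V \<le> (\<Sum>i\<in>UNIV. C q M * (block_part blk i v \<bullet> block_part blk i v))"
      unfolding V_def
    proof (rule sum_mono)
      fix i
      have "block_part blk i v \<bullet> (H h i *v block_part blk i v) / w i
          \<le> M i * (norm (block_part blk i v))\<^sup>2 / w i"
        using loewner_ge_quadratic[OF M[of i], of "block_part blk i v"] w[of i]
          block_id_quadratic[of "block_part blk i v" blk i "M i"]
        by (intro divide_right_mono) auto
      also have "\<dots> = M i / (pmf q i * abar i) * (norm (block_part blk i v))\<^sup>2"
        by (simp add: w_def mult.commute)
      also have "\<dots> \<le> C q M * (norm (block_part blk i v))\<^sup>2"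
        by (intro mult_right_mono C_ge q) auto
      finally show "block_part blk i v \<bullet> (H h i *v block_part blk i v) / w i
          \<le> C q M * (block_part blk i v \<bullet> block_part blk i v)"
        by (simp add: power2_norm_eq_inner)
    qed
    also have "\<dots> = C q M * (norm v)\<^sup>2"
      by (simp only: sum_distrib_left[symmetric] inner_sum_blocks power2_norm_eq_inner)
    also have "\<dots> \<le> C q M * R0\<^sup>2"
      using R0[of h] C0 by (intro mult_left_mono power_mono) (auto simp: v_def)
    finally have V: "V \<le> C q M * R0\<^sup>2" .
    have "measure_pmf.expectation (p h) (\<lambda>i. gap (i # h))
      \<le> gap h - (1 - \<eta>) * \<gamma> * (\<theta> * pibar q * gap h - (\<theta> * pibar q)\<^sup>2 / 2 * V)"
      unfolding V_def v_def
    proof (rule decrease)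
      show "w i \<le> pmf (p h) i * \<alpha> h i" for i
        using mult_left_mono[OF abar_le[of i h], of "pmf q i"] by (simp add: w_def q(2) mult.commute)
      show "pibar q \<le> w i" for i unfolding w_def by (rule pibar_le)
      show "0 \<le> pibar q" using pibar_pos q(1) less_imp_le by blast
    qed (use w \<theta> in auto)
    also have "\<dots> \<le> gap h - (1 - \<eta>) * \<gamma> * (\<theta> * pibar q * gap h - (\<theta> * pibar q)\<^sup>2 / 2 * (C q M * R0\<^sup>2))"
      using V eta gamma by (intro diff_left_mono mult_left_mono) auto
    finally show ?thesis by simp
  qed

  have run_step: "measure_pmf.expectation (run_pmf p (Suc n) h) gap
      \<le> measure_pmf.expectation (run_pmf p n h) gap - (1 - \<eta>) * \<gamma> *
          (\<theta> * pibar q * measure_pmf.expectation (run_pmf p n h) gap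
            - (\<theta> * pibar q)\<^sup>2 * (C q M * R0\<^sup>2) / 2)"
    if q: "\<And>i. pmf q i > 0" "\<And>l. p (l @ h) = q" and M: "\<And>l i. M i *\<^sub>R block_id blk i \<succeq> H (l @ h) i"
      and \<theta>: "0 \<le> \<theta>" "\<theta> \<le> 1" for h q M \<theta> n
  proof -
    define a where "a = 1 - (1 - \<eta>) * \<gamma> * (\<theta> * pibar q)"
    define b where "b = (1 - \<eta>) * \<gamma> * ((\<theta> * pibar q)\<^sup>2 * (C q M * R0\<^sup>2) / 2)"
    have ab: "x - (1 - \<eta>) * \<gamma> * (\<theta> * pibar q * x - (\<theta> * pibar q)\<^sup>2 * (C q M * R0\<^sup>2) / 2)
        = a * x + b" for x :: real
      unfolding a_def b_def by (simp only: left_diff_distrib right_diff_distrib mult_1_left mult.assoc)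
    show ?thesis
      unfolding ab
      by (rule expectation_run_pmf_step, unfold ab[symmetric], rule fixed_decrease[OF q M \<theta>])
  qed
  have rate: "0 < (1 - \<eta>) * \<gamma>" "(1 - \<eta>) * \<gamma> \<le> 1"
    using eta gamma by (auto intro!: mult_le_one)
  have C_nonneg: "0 \<le> C q M" for q M unfolding C_def by (rule onorm_pos_le) simp
  have run_nonneg: "0 \<le> measure_pmf.expectation (run_pmf p n h) gap" for n h
    using gap_nonneg by (simp add: Bochner_Integration.integral_nonneg)
  have N: "1 \<le> real CARD('b)" by (simp add: Suc_le_eq)

  have part2: "measure_pmf.expectation (run_pmf p (k - length h) h) (\<lambda>h'. real_of_ereal (F (X h'))) - Fmin
             \<le> 2 * C q M * R0\<^sup>2
                 / (2 * real CARD('b) + (1 - \<eta>) * \<gamma> * (real k - real (length h)))"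
    if q: "\<And>i. pmf q i > 0" "\<And>l. p (l @ h) = q" and M: "\<And>l i. M i *\<^sub>R block_id blk i \<succeq> H (l @ h) i"
      and start: "gap h < C q M * pibar q * R0\<^sup>2" and k: "k \<ge> length h" for M q h k
  proof -
    have mean: "measure_pmf.expectation (run_pmf p n h) (\<lambda>h'. real_of_ereal (F (X h'))) - Fmin
        = measure_pmf.expectation (run_pmf p n h) gap" for n
      unfolding gap_def by (simp add: integrable_run_pmf)
    have bound: "measure_pmf.expectation (run_pmf p n h) gap
        \<le> 2 * (C q M * R0\<^sup>2) / (2 * real CARD('b) + (1 - \<eta>) * \<gamma> * real n)" for n
      by (rule recursion_sublinear[where \<delta> = "\<lambda>n. measure_pmf.expectation (run_pmf p n h) gap"
            and \<pi> = "pibar q"])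
         (use run_step[OF q M] run_nonneg rate N pibar_le_N C_nonneg start in \<open>auto simp: mult_ac\<close>)
    show ?thesis
      using bound[of "k - length h"] k unfolding mean by (simp add: of_nat_diff mult.assoc)
  qed

  have part3: "let k0 = (if gap [] = 0 then 0
                   else nat \<lceil>max 0 (ln (gap [] / (C q M * pibar q * R0\<^sup>2))
                                  / ln (2 / (2 - (1 - \<eta>) * \<gamma> * pibar q)))\<rceil>)
         in (\<forall>k<k0. measure_pmf.expectation (run_pmf p k []) gap
                      \<le> (1 - (1 - \<eta>) * \<gamma> * pibar q / 2) ^ k * gap []) \<and>
            (\<forall>k\<ge>k0. measure_pmf.expectation (run_pmf p k []) gap
                      \<le> 2 * C q M * R0\<^sup>2
                          / (2 * real CARD('b) + (1 - \<eta>) * \<gamma> * (real k - real k0)))"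
    if q: "\<And>i. pmf q i > 0" "\<And>h. p h = q" and M: "\<And>h i. M i *\<^sub>R block_id blk i \<succeq> H h i"
      and Mm: "\<And>i. m i \<le> M i" for M q
  proof -
    let ?k0 = "if gap [] = 0 then 0
      else nat \<lceil>max 0 (ln (gap [] / (C q M * pibar q * R0\<^sup>2)) / ln (2 / (2 - (1 - \<eta>) * \<gamma> * pibar q)))\<rceil>"
    define \<delta> where "\<delta> k = measure_pmf.expectation (run_pmf p k []) gap" for k
    have \<delta>_step: "\<delta> (Suc k) \<le> \<delta> k - (1 - \<eta>) * \<gamma> *
        (\<theta> * pibar q * \<delta> k - (\<theta> * pibar q)\<^sup>2 * (C q M * R0\<^sup>2) / 2)"
      if "0 \<le> \<theta>" "\<theta> \<le> 1" for k \<theta>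
      unfolding \<delta>_def by (rule run_step) (use q M that in auto)
    have \<delta>_0: "\<delta> 0 = gap []" by (simp add: \<delta>_def)
    \<comment> \<open>A positive initial gap forces \<open>R0 > 0\<close>, because the starting point lies in its own level set.\<close>
    have K_pos: "0 < C q M * R0\<^sup>2" if "\<delta> 0 \<noteq> 0"
    proof -
      have "X [] \<noteq> proj (X [])" using that proj(2)[of "X []"] by (auto simp: gap \<delta>_0)
      then have "0 < norm (X [] - proj (X []))" by simp
      then have "R0 > 0" using R0[of "[]"] by linarith
      moreover have "0 < M i / (pmf q i * abar i)" for i
        using m_pos[of i] Mm[of i] q(1)[of i] abar_pos[of i] by simp
      then have "C q M > 0" using C_ge[OF q(1), of M] less_le_trans by blast
      ultimately show ?thesis by simp
    qed
    have k0: "?k0 = (if \<delta> 0 = 0 then 0 else nat \<lceil>max 0 (ln (\<delta> 0 / (C q M * R0\<^sup>2 * pibar q))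
        / ln (2 / (2 - (1 - \<eta>) * \<gamma> * pibar q)))\<rceil>)"
      by (simp add: \<delta>_0 mult_ac)
    have \<delta>_nonneg: "0 \<le> \<delta> k" for k unfolding \<delta>_def by (rule run_nonneg)
    have K_nonneg: "0 \<le> C q M * R0\<^sup>2" by (simp add: C_nonneg)
    note phases = recursion_two_phases[of \<delta> "(1 - \<eta>) * \<gamma>" "pibar q" "C q M * R0\<^sup>2",
        OF \<delta>_step \<delta>_nonneg K_nonneg K_pos rate N pibar_pos[OF q(1)] pibar_le_N k0]
    show ?thesis
      unfolding Let_def using phases unfolding \<delta>_0 unfolding \<delta>_def by (simp add: mult.assoc)
  qed

  show ?thesis
  proof (intro conjI allI impI)
    show "\<bar>F (X h)\<bar> \<noteq> \<infinity>" for h by (simp add: F_X)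
  next
    fix h
    show "let \<pi> = (MIN i. \<alpha> h i * pmf (p h) i);
              P = block_diag blk (\<lambda>i. pmf (p h) i *\<^sub>R block_id blk i);
              A = block_diag blk (\<lambda>i. \<alpha> h i *\<^sub>R block_id blk i);
              Hk = block_diag blk (H h);
              v = X h - proj (X h)
          in gap h > 0 \<longrightarrow>
             gap h \<ge> (v \<bullet> ((matrix_inv P ** matrix_inv A ** Hk) *v v)) * \<pi> \<longrightarrow>
             measure_pmf.expectation (p h) (\<lambda>i. gap (i # h)) / gap h
               \<le> 1 - (1 - \<eta>) * \<gamma> * \<pi> / 2"
      by (rule part1)
  qed (rule part2 part3; blast)+
qed

end
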